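(* (1) Let $(X,\mathcal{W},\mathcal{B},\mu)$ be a space with measured walls and let $\mathcal{M}(X)$ be its canonically associated space of admissible sections (defined in the context). Then $\mathcal{M}(X)$ is a median (pseudo-metric) space and $X$, with its wall pseudo-metric, embeds isometrically in $\mathcal{M}(X)$, via $x\mapsto\sigma_x$. Moreover, any homomorphism $\phi:X\to X'$ between two spaces with measured walls induces an isometry $\mathcal{M}(X)\to\mathcal{M}(X')$, namely $\sigma\mapsto\{h'\in\mathcal{H}'\; ;\; \phi^{-1}(h')\in\sigma\}$. (2) Any median space $(X,\mathrm{dist})$ has a canonical structure of space with measured walls (defined in the context), and the wall metric coincides with the original metric. Moreover, any surjective isometry between median spaces is an isomorphism between the canonical structures of spaces with measured walls. (3) Any median space $(X,\mathrm{dist})$ embeds isometrically in $L^1(\mathcal{W},\mu)$, for some measured space $(\mathcal{W},\mu)$.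
   Context: Median spaces. A pseudo-metric on $X$ is a symmetric map $\mathrm{pdist}:X\times X\to[0,\infty)$ vanishing on the diagonal and satisfying the triangle inequality. The interval $I(a,b)$ is the set of points $x$ with $\mathrm{pdist}(a,x)+\mathrm{pdist}(x,b)=\mathrm{pdist}(a,b)$; put $M(a,b,c)=I(a,b)\cap I(b,c)\cap I(a,c)$. A median pseudo-metric space is a pseudo-metric space in which every $M(a,b,c)$ is non-empty and of diameter $0$. A median space is a median metric space, i.e. a metric space in which each $M(a,b,c)$ is a single point. An isometry (isometric embedding) between pseudo-metric spaces is a distance-preserving map (not necessarily injective for pseudo-metrics). Measured walls. A wall of a set $X$ is a partition $X=h\sqcup h^c$ ($h$ possibly empty or all of $X$). A collection of half-spaces is a set $\mathcal{H}$ of subsets of $X$ closed under complementation; the associated collection of walls $\mathcal{W}$ is the set of pairs $\{h,h^c\}$, $h\in\mathcal{H}$. A wall $\{h,h^c\}$ separates $x$ from $y$ if one of $x,y$ is in $h$ and the other in $h^c$; $\mathcal{W}(x|y)$ is the set of walls in $\mathcal{W}$ separating $x$ from $y$ (so $\mathcal{W}(x|x)=\emptyset$). A space with measured walls is a 4-tuple $(X,\mathcal{W},\mathcal{B},\mu)$ where $\mathcal{W}$ is a collection of walls, $\mathcal{B}$ is a $\sigma$-algebra on $\mathcal{W}$ and $\mu$ is a measure on $\mathcal{B}$ such that for all $x,y\in X$, $\mathcal{W}(x|y)\in\mathcal{B}$ and $\mu(\mathcal{W}(x|y))<\infty$. The wall pseudo-metric is $\mathrm{pdist}_\mu(x,y)=\mu(\mathcal{W}(x|y))$.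 A homomorphism between spaces with measured walls $(X,\mathcal{W},\mathcal{B},\mu)$ and $(X',\mathcal{W}',\mathcal{B}',\mu')$ is a map $\phi:X\to X'$ such that for every $w'=\{h',h'^c\}\in\mathcal{W}'$ the wall $\phi^*(w')=\{\phi^{-1}(h'),\phi^{-1}(h'^c)\}$ is in $\mathcal{W}$, the map $\phi^*:\mathcal{W}'\to\mathcal{W}$ is surjective, and for every $B\in\mathcal{B}$, $(\phi^* )^{-1}(B)\in\mathcal{B}'$ and $\mu'((\phi^* )^{-1}(B))=\mu(B)$. An isomorphism is a bijective homomorphism whose inverse is a homomorphism. The space $\mathcal{M}(X)$. Let $\mathcal{H}$ be the set of half-spaces of $(X,\mathcal{W},\mathcal{B},\mu)$, $\mathfrak{p}:\mathcal{H}\to\mathcal{W}$, $h\mapsto\{h,h^c\}$, and let $\mathcal{B}^{\mathcal{H}}=\{\mathfrak{p}^{-1}(B)\; ;\; B\in\mathcal{B}\}$ with measure $\mu(\mathfrak{p}^{-1}(B)):=\mu(B)$. An admissible section is a subset $\sigma\subset\mathcal{H}$ containing exactly one of $h,h^c$ for each wall $\{h,h^c\}\in\mathcal{W}$ and such that $h\in\sigma$, $h\subset h'\in\mathcal{H}$ imply $h'\in\sigma$. For $x\in X$, $\sigma_x=\{h\in\mathcal{H}\; ;\; x\in h\}$ is an admissible section. $\mathcal{M}(X)$ is the set of admissible sections $\sigma$ such that $\sigma\vartriangle\sigma_{x_0}\in\mathcal{B}^{\mathcal{H}}$ and $\mu(\sigma\vartriangle\sigma_{x_0})<\infty$ for some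 (equivalently any) $x_0\in X$, with pseudo-metric $\mathrm{pdist}_\mu(\sigma,\sigma')=\mu(\sigma\vartriangle\sigma')$. Canonical structure on a median space $(X,\mathrm{dist})$. A subset $A\subset X$ is convex if $I(a,b)\subset A$ for all $a,b\in A$; a convex wall is a wall $\{h,h^c\}$ with both $h$ and $h^c$ convex. $\mathcal{W}$ is the set of all convex walls, $\mathcal{B}$ is the $\sigma$-algebra on $\mathcal{W}$ generated by the sets $\mathcal{W}(x|y)$, $x,y\in X$, and $\mu$ is the restriction to $\mathcal{B}$ of the outer measure $\mu^*(Q)=\inf\{\sum_{n}\mathrm{dist}(x_n,y_n)\; ;\; Q\subset\bigcup_{n\in\mathbb{N}}\mathcal{W}(x_n|y_n)\}$ (with $\inf\emptyset=+\infty$). *)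

theory Defs
  imports "HOL-Analysis.Analysis"
begin

section \<open>Median spaces\<close>

definition pseudo_metric_on :: "'a set \<Rightarrow> ('a \<Rightarrow> 'a \<Rightarrow> real) \<Rightarrow> bool" where
  "pseudo_metric_on X d \<longleftrightarrow>
     (\<forall>x\<in>X. \<forall>y\<in>X. 0 \<le> d x y \<and> d x y = d y x) \<and>
     (\<forall>x\<in>X. d x x = 0) \<and>
     (\<forall>x\<in>X. \<forall>y\<in>X. \<forall>z\<in>X. d x z \<le> d x y + d y z)"

definition metric_interval :: "'a set \<Rightarrow> ('a \<Rightarrow> 'a \<Rightarrow> real) \<Rightarrow> 'a \<Rightarrow> 'a \<Rightarrow> 'a set" where
  "metric_interval X d a b = {x \<in> X. d a x + d x b = d a b}"

definition median_set :: "'a set \<Rightarrow> ('a \<Rightarrow> 'a \<Rightarrow> real) \<Rightarrow> 'a \<Rightarrow> 'a \<Rightarrow> 'a \<Rightarrow> 'a set" where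
  "median_set X d a b c =
     metric_interval X d a b \<inter> metric_interval X d b c \<inter> metric_interval X d a c"

definition median_pseudo_metric_space :: "'a set \<Rightarrow> ('a \<Rightarrow> 'a \<Rightarrow> real) \<Rightarrow> bool" where
  "median_pseudo_metric_space X d \<longleftrightarrow>
     pseudo_metric_on X d \<and>
     (\<forall>a\<in>X. \<forall>b\<in>X. \<forall>c\<in>X.
        median_set X d a b c \<noteq> {} \<and>
        (\<forall>x\<in>median_set X d a b c. \<forall>y\<in>median_set X d a b c. d x y = 0))"

definition median_space :: "'a set \<Rightarrow> ('a \<Rightarrow> 'a \<Rightarrow> real) \<Rightarrow> bool" where
  "median_space X d \<longleftrightarrow>
     Metric_space X d \<and> (\<forall>a\<in>X. \<forall>b\<in>X. \<forall>c\<in>X. \<exists>m. median_set X d a b c = {m})"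

definition isometric_embedding ::
  "'a set \<Rightarrow> ('a \<Rightarrow> 'a \<Rightarrow> real) \<Rightarrow> 'b set \<Rightarrow> ('b \<Rightarrow> 'b \<Rightarrow> real) \<Rightarrow> ('a \<Rightarrow> 'b) \<Rightarrow> bool" where
  "isometric_embedding X d X' d' f \<longleftrightarrow>
     f \<in> X \<rightarrow> X' \<and> (\<forall>x\<in>X. \<forall>y\<in>X. d' (f x) (f y) = d x y)"


section \<open>Spaces with measured walls\<close>

text \<open>A wall of \<open>X\<close> is the unordered pair \<open>{h, X - h}\<close>, a set of sets. The triple
  \<open>(\<W>, \<B>, \<mu>)\<close> is a single measure \<open>N\<close> with \<open>\<W> = space N\<close> and \<open>\<B> = sets N\<close>.\<close>

definition halfspace_collection :: "'a set \<Rightarrow> 'a set set \<Rightarrow> bool" where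
  "halfspace_collection X H \<longleftrightarrow> (\<forall>h\<in>H. h \<subseteq> X \<and> X - h \<in> H)"

definition wall_of :: "'a set \<Rightarrow> 'a set \<Rightarrow> 'a set set" where
  "wall_of X h = {h, X - h}"

text \<open>For \<open>h \<subseteq> X\<close> the existential ranges over both sides of the wall, so this is
  symmetric in \<open>x\<close> and \<open>y\<close>.\<close>

definition separates :: "'a set \<Rightarrow> 'a set set \<Rightarrow> 'a \<Rightarrow> 'a \<Rightarrow> bool" where
  "separates X w x y \<longleftrightarrow> (\<exists>h. w = wall_of X h \<and> x \<in> h \<and> y \<in> X - h)"

definition walls_between :: "'a set \<Rightarrow> 'a set set set \<Rightarrow> 'a \<Rightarrow> 'a \<Rightarrow> 'a set set set" where
  "walls_between X W x y = {w \<in> W. separates X w x y}"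

definition measured_walls :: "'a set \<Rightarrow> 'a set set measure \<Rightarrow> bool" where
  "measured_walls X N \<longleftrightarrow>
     (\<exists>H. halfspace_collection X H \<and> space N = wall_of X ` H) \<and>
     (\<forall>x\<in>X. \<forall>y\<in>X. walls_between X (space N) x y \<in> sets N \<and>
                     emeasure N (walls_between X (space N) x y) < \<infinity>)"

definition wall_pdist :: "'a set \<Rightarrow> 'a set set measure \<Rightarrow> 'a \<Rightarrow> 'a \<Rightarrow> real" where
  "wall_pdist X N x y = measure N (walls_between X (space N) x y)"

definition wall_pullback :: "'a set \<Rightarrow> ('a \<Rightarrow> 'b) \<Rightarrow> 'b set set \<Rightarrow> 'a set set" where
  "wall_pullback X \<phi> w' = (\<lambda>h'. \<phi> -` h' \<inter> X) ` w'"

definition wall_hom ::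
  "'a set \<Rightarrow> 'a set set measure \<Rightarrow> 'b set \<Rightarrow> 'b set set measure \<Rightarrow> ('a \<Rightarrow> 'b) \<Rightarrow> bool" where
  "wall_hom X N X' N' \<phi> \<longleftrightarrow>
     \<phi> \<in> X \<rightarrow> X' \<and>
     (\<forall>w'\<in>space N'. wall_pullback X \<phi> w' \<in> space N) \<and>
     wall_pullback X \<phi> ` space N' = space N \<and>
     (\<forall>B\<in>sets N. wall_pullback X \<phi> -` B \<inter> space N' \<in> sets N' \<and>
                  emeasure N' (wall_pullback X \<phi> -` B \<inter> space N') = emeasure N B)"

definition wall_iso ::
  "'a set \<Rightarrow> 'a set set measure \<Rightarrow> 'b set \<Rightarrow> 'b set set measure \<Rightarrow> ('a \<Rightarrow> 'b) \<Rightarrow> bool" where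
  "wall_iso X N X' N' \<phi> \<longleftrightarrow>
     bij_betw \<phi> X X' \<and> wall_hom X N X' N' \<phi> \<and> wall_hom X' N' X N (inv_into X \<phi>)"


section \<open>The space of admissible sections\<close>

definition halfspaces :: "'a set set measure \<Rightarrow> 'a set set" where
  "halfspaces N = \<Union> (space N)"

text \<open>The \<open>\<sigma>\<close>-algebra consists of the preimages \<open>\<pp>\<^sup>-\<^sup>1(B)\<close>, \<open>B \<in> sets N\<close>, under
  \<open>\<pp> = wall_of X\<close>, and \<open>\<pp>\<^sup>-\<^sup>1(B)\<close> has the measure of \<open>B = \<pp>(\<pp>\<^sup>-\<^sup>1(B))\<close>; see
  \<open>sets_halfspace_measure\<close> and \<open>emeasure_halfspace_measure\<close>.\<close>

definition halfspace_measure :: "'a set \<Rightarrow> 'a set set measure \<Rightarrow> 'a set measure" where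
  "halfspace_measure X N =
     measure_of (halfspaces N)
       {wall_of X -` B \<inter> halfspaces N | B. B \<in> sets N}
       (\<lambda>A. emeasure N (wall_of X ` A))"

definition admissible_section :: "'a set set measure \<Rightarrow> 'a set set \<Rightarrow> bool" where
  "admissible_section N \<sigma> \<longleftrightarrow>
     \<sigma> \<subseteq> halfspaces N \<and>
     (\<forall>w\<in>space N. \<exists>!h. h \<in> w \<and> h \<in> \<sigma>) \<and>
     (\<forall>h\<in>\<sigma>. \<forall>h'\<in>halfspaces N. h \<subseteq> h' \<longrightarrow> h' \<in> \<sigma>)"

definition point_section :: "'a set set measure \<Rightarrow> 'a \<Rightarrow> 'a set set" where
  "point_section N x = {h \<in> halfspaces N. x \<in> h}"

definition section_space :: "'a set \<Rightarrow> 'a set set measure \<Rightarrow> 'a set set set" where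
  "section_space X N =
     {\<sigma>. admissible_section N \<sigma> \<and>
         (\<exists>x\<^sub>0\<in>X. sym_diff \<sigma> (point_section N x\<^sub>0) \<in> sets (halfspace_measure X N) \<and>
                 emeasure (halfspace_measure X N) (sym_diff \<sigma> (point_section N x\<^sub>0)) < \<infinity>)}"

definition section_pdist ::
  "'a set \<Rightarrow> 'a set set measure \<Rightarrow> 'a set set \<Rightarrow> 'a set set \<Rightarrow> real" where
  "section_pdist X N \<sigma> \<tau> = measure (halfspace_measure X N) (sym_diff \<sigma> \<tau>)"

definition induced_section_map ::
  "'a set \<Rightarrow> 'b set set measure \<Rightarrow> ('a \<Rightarrow> 'b) \<Rightarrow> 'a set set \<Rightarrow> 'b set set" where
  "induced_section_map X N' \<phi> \<sigma> = {h' \<in> halfspaces N'. \<phi> -` h' \<inter> X \<in> \<sigma>}"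

lemma wall_of_halfspace:
  assumes "measured_walls X N" "h \<in> halfspaces N"
  shows "wall_of X h \<in> space N"
proof -
  obtain H where H: "halfspace_collection X H" "space N = wall_of X ` H"
    using assms(1) unfolding measured_walls_def by blast
  obtain k where k: "k \<in> H" "h = k \<or> h = X - k"
    using assms(2) H(2) unfolding halfspaces_def wall_of_def by auto
  have "k \<subseteq> X" using H(1) k(1) unfolding halfspace_collection_def by blast
  then have "wall_of X h = wall_of X k" using k(2) unfolding wall_of_def by auto
  then show ?thesis using H(2) k(1) by auto
qed

lemma wall_of_surj:
  assumes "measured_walls X N" "w \<in> space N"
  shows "\<exists>h\<in>halfspaces N. wall_of X h = w"
  using assms unfolding measured_walls_def halfspaces_def wall_of_def by fastforce

lemma wall_of_image_vimage:
  assumes "measured_walls X N" "B \<subseteq> space N"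
  shows "wall_of X ` (wall_of X -` B \<inter> halfspaces N) = B"
  using wall_of_surj[OF assms(1)] assms(2) by fastforce

lemma sets_halfspace_measure:
  assumes "measured_walls X N"
  shows "sets (halfspace_measure X N) = {wall_of X -` B \<inter> halfspaces N | B. B \<in> sets N}"
proof -
  have f: "wall_of X \<in> halfspaces N \<rightarrow> space N"
    using wall_of_halfspace[OF assms] by auto
  have eq: "{wall_of X -` B \<inter> halfspaces N | B. B \<in> sets N}
      = sets (vimage_algebra (halfspaces N) (wall_of X) N)"
    using sets_vimage_algebra2[OF f] by auto
  show ?thesis
    unfolding halfspace_measure_def eq
    by (metis sets_measure_of sets.sigma_sets_eq sets.space_closed space_vimage_algebra)
qed

lemma emeasure_halfspace_measure:
  assumes "measured_walls X N" "B \<in> sets N"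
  shows "emeasure (halfspace_measure X N) (wall_of X -` B \<inter> halfspaces N) = emeasure N B"
proof -
  let ?p = "wall_of X" let ?H = "halfspaces N"
  let ?S = "{?p -` B \<inter> ?H | B. B \<in> sets N}"
  let ?m = "\<lambda>A. emeasure N (?p ` A)"
  note im = wall_of_image_vimage[OF assms(1)]
  have S: "?S \<subseteq> Pow ?H" by auto
  have sets: "sets (halfspace_measure X N) = ?S"
    by (rule sets_halfspace_measure[OF assms(1)])
  have ca: "countably_additive ?S ?m"
  proof (rule countably_additiveI)
    fix A :: "nat \<Rightarrow> _" assume A: "range A \<subseteq> ?S" "disjoint_family A"
    then have "\<forall>i. \<exists>B. B \<in> sets N \<and> A i = ?p -` B \<inter> ?H" by blast
    then obtain C where C: "\<And>i. C i \<in> sets N" "\<And>i. A i = ?p -` C i \<inter> ?H" by metis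
    have pA: "?p ` A i = C i" for i
      using C im sets.sets_into_space by metis
    have "disjoint_family C"
      unfolding disjoint_family_on_def
    proof (intro ballI impI)
      fix i j :: nat assume "i \<noteq> j"
      then have "A i \<inter> A j = {}" using A(2) by (auto simp: disjoint_family_on_def)
      then have "?p -` (C i \<inter> C j) \<inter> ?H = {}" using C(2) by auto
      moreover have "C i \<inter> C j \<subseteq> space N" using C(1) sets.sets_into_space by blast
      ultimately show "C i \<inter> C j = {}" using im by (metis image_empty)
    qed
    then have "(\<Sum>i. emeasure N (C i)) = emeasure N (\<Union>i. C i)"
      using C(1) by (intro suminf_emeasure) auto
    then show "(\<Sum>i. ?m (A i)) = ?m (\<Union>i. A i)"
      by (simp add: pA image_UN)
  qed
  have "emeasure (halfspace_measure X N) (?p -` B \<inter> ?H) = ?m (?p -` B \<inter> ?H)"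
  proof (rule emeasure_measure_of[OF halfspace_measure_def S])
    show "positive (sets (halfspace_measure X N)) ?m"
      by (simp add: positive_def)
    show "countably_additive (sets (halfspace_measure X N)) ?m"
      using ca sets by simp
    show "?p -` B \<inter> ?H \<in> sets (halfspace_measure X N)"
      using assms(2) sets by auto
  qed
  then show ?thesis
    using im assms(2) sets.sets_into_space by metis
qed


section \<open>The canonical measured walls of a median space\<close>

definition median_convex :: "'a set \<Rightarrow> ('a \<Rightarrow> 'a \<Rightarrow> real) \<Rightarrow> 'a set \<Rightarrow> bool" where
  "median_convex X d A \<longleftrightarrow> A \<subseteq> X \<and> (\<forall>a\<in>A. \<forall>b\<in>A. metric_interval X d a b \<subseteq> A)"

definition convex_walls :: "'a set \<Rightarrow> ('a \<Rightarrow> 'a \<Rightarrow> real) \<Rightarrow> 'a set set set" where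
  "convex_walls X d = wall_of X ` {h. median_convex X d h \<and> median_convex X d (X - h)}"

text \<open>Covers are indexed by all of \<open>nat\<close>; as \<open>x = y\<close> contributes the empty set of walls at no
  cost, finite covers are included. For \<open>X = {}\<close> there are no covers, and even the empty
  set gets the value \<open>\<infinity>\<close>.\<close>

definition wall_outer_measure ::
  "'a set \<Rightarrow> ('a \<Rightarrow> 'a \<Rightarrow> real) \<Rightarrow> 'a set set set \<Rightarrow> ennreal" where
  "wall_outer_measure X d Q =
     Inf {(\<Sum>n. ennreal (d (x n) (y n))) | x y :: nat \<Rightarrow> 'a.
            range x \<subseteq> X \<and> range y \<subseteq> X \<and>
            Q \<subseteq> (\<Union>n. walls_between X (convex_walls X d) (x n) (y n))}"

definition canonical_walls :: "'a set \<Rightarrow> ('a \<Rightarrow> 'a \<Rightarrow> real) \<Rightarrow> 'a set set measure" where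
  "canonical_walls X d =
     measure_of (convex_walls X d)
       {walls_between X (convex_walls X d) x y | x y. x \<in> X \<and> y \<in> X}
       (wall_outer_measure X d)"


section \<open>The space \<open>L\<^sup>1\<close>\<close>

text \<open>Real-valued integrable functions modulo equality almost everywhere.\<close>

definition L1_rel :: "'w measure \<Rightarrow> (('w \<Rightarrow> real) \<times> ('w \<Rightarrow> real)) set" where
  "L1_rel N = {(f, g). integrable N f \<and> integrable N g \<and> (AE w in N. f w = g w)}"

definition L1_space :: "'w measure \<Rightarrow> ('w \<Rightarrow> real) set set" where
  "L1_space N = {f. integrable N f} // L1_rel N"

definition L1_dist :: "'w measure \<Rightarrow> ('w \<Rightarrow> real) set \<Rightarrow> ('w \<Rightarrow> real) set \<Rightarrow> real" where
  "L1_dist N F G = (THE r. \<exists>f\<in>F. \<exists>g\<in>G. r = (\<integral>w. \<bar>f w - g w\<bar> \<partial>N))"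

lemma L1_dist_class:
  assumes "integrable N f" "integrable N g"
  shows "L1_dist N (L1_rel N `` {f}) (L1_rel N `` {g}) = (\<integral>w. \<bar>f w - g w\<bar> \<partial>N)"
  unfolding L1_dist_def
proof (rule the_equality)
  show "\<exists>f'\<in>L1_rel N `` {f}. \<exists>g'\<in>L1_rel N `` {g}.
      (\<integral>w. \<bar>f w - g w\<bar> \<partial>N) = (\<integral>w. \<bar>f' w - g' w\<bar> \<partial>N)"
    using assms by (intro bexI[of _ f] bexI[of _ g]) (auto simp: L1_rel_def)
next
  fix r assume "\<exists>f'\<in>L1_rel N `` {f}. \<exists>g'\<in>L1_rel N `` {g}. r = (\<integral>w. \<bar>f' w - g' w\<bar> \<partial>N)"
  then obtain f' g' where r: "r = (\<integral>w. \<bar>f' w - g' w\<bar> \<partial>N)"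
    and i: "integrable N f'" "integrable N g'"
    and f: "AE w in N. f w = f' w" and g: "AE w in N. g w = g' w"
    by (auto simp: L1_rel_def)
  have "AE w in N. \<bar>f' w - g' w\<bar> = \<bar>f w - g w\<bar>" using f g by eventually_elim simp
  then show "r = (\<integral>w. \<bar>f w - g w\<bar> \<partial>N)"
    unfolding r using assms i by (intro integral_cong_AE) auto
qed

end

theory Submission
  imports Defs
begin

text \<open>
  For admissible sections the median is the majority vote:
  \<open>m = (a \<inter> b) \<union> (b \<inter> c) \<union> (a \<inter> c)\<close> is again admissible, and \<open>a\<close> and \<open>m\<close> differ exactly
  where \<open>a\<close> differs from both \<open>b\<close> and \<open>c\<close>. Since
  \<open>\<mu> (a \<triangle> x) + \<mu> (x \<triangle> b) = \<mu> (a \<triangle> b) + 2 \<mu> ((a \<triangle> x) \<inter> (x \<triangle> b))\<close>, the point \<open>x\<close> is between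
  \<open>a\<close> and \<open>b\<close> iff the last intersection is null. This puts \<open>m\<close> in the median set, and it
  makes the median set have diameter \<open>0\<close>: wherever two of its elements differ, one of
  them disagrees with two of \<open>a\<close>, \<open>b\<close>, \<open>c\<close>. A homomorphism pulls a half-space back to a
  half-space, so the set where two induced sections differ is the preimage of the set
  where the given ones differ, and it has the same measure.

  For the canonical walls of a median space, the point is that the outer measure \<open>\<mu>\<close>
  gives \<open>\<W>(x|y)\<close> the value \<open>dist x y\<close> and that every \<open>\<W>(a|b)\<close> is Caratheodory measurable.
  The latter is combinatorial: projecting \<open>a\<close> and \<open>b\<close> to the interval from \<open>x\<close> to \<open>y\<close>
  cuts \<open>\<W>(x|y)\<close> along \<open>\<W>(a|b)\<close> into four sets of the form \<open>\<W>(p|q)\<close> whose lengths add up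
  to \<open>dist x y\<close> (\<open>walls_between_split\<close>). The former says that \<open>\<W>(x|y) \<subseteq> (\<Union>n. \<W>(s n|t n))\<close>
  forces \<open>dist x y \<le> (\<Sum>n. dist (s n) (t n))\<close>. As all convex walls are used, the
  half-spaces containing \<open>x\<close> but not \<open>y\<close> form a compact set in the product topology on
  predicates, so a finite part of the cover suffices (\<open>finite_subcover\<close>). For finite
  covers one inducts on their size (\<open>dist_le_sum_finite_oriented\<close>): projecting a covering
  pair yields points \<open>q\<close>, \<open>b'\<close> with \<open>x, q, b', y\<close> aligned; the pair pays for the segment
  from \<open>q\<close> to \<open>b'\<close>, and each remaining pair is cut at a median point into one part for
  each of the two segments left over. The induction starts from the fact that two
  distinct points are separated by a convex wall (\<open>separation\<close>), which follows from
  Zorn's lemma and the convexity of the join of a point and a convex set. What is needed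
  of medians is that \<open>med x y a\<close> is the gate of \<open>a\<close> in the interval from \<open>x\<close> to \<open>y\<close>;
  hence \<open>med x y\<close> is 1-Lipschitz.

  Pulling back covers along a bijective isometry and its inverse shows that the canonical
  structures correspond. Finally, for a base point \<open>z\<close>, the map sending \<open>x\<close> to the
  indicator function of \<open>\<W>(z|x)\<close> embeds the space in \<open>L\<^sup>1\<close>, because two such functions
  differ exactly on \<open>\<W>(x|y)\<close>.
\<close>

section \<open>Admissible sections\<close>

lemma separates_wall_of:
  assumes "h \<subseteq> X" "x \<in> X" "y \<in> X"
  shows "separates X (wall_of X h) x y \<longleftrightarrow> (x \<in> h) \<noteq> (y \<in> h)"
proof
  assume "separates X (wall_of X h) x y"
  then obtain k where k: "wall_of X h = wall_of X k" "x \<in> k" "y \<in> X - k"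
    unfolding separates_def by blast
  then have "k \<in> {h, X - h}" by (auto simp: wall_of_def)
  then show "(x \<in> h) \<noteq> (y \<in> h)" using k by auto
next
  assume "(x \<in> h) \<noteq> (y \<in> h)"
  moreover have "wall_of X h = wall_of X (X - h)" using assms(1) by (auto simp: wall_of_def)
  ultimately show "separates X (wall_of X h) x y"
    unfolding separates_def using assms by (cases "x \<in> h") auto
qed

lemma halfspace_wall:
  assumes "measured_walls X N" "h \<in> halfspaces N"
  shows "h \<subseteq> X" "X - h \<in> halfspaces N" "wall_of X h \<in> space N"
proof -
  show 1: "wall_of X h \<in> space N" by (rule wall_of_halfspace[OF assms])
  obtain H where H: "halfspace_collection X H" "space N = wall_of X ` H"
    using assms(1) unfolding measured_walls_def by blast
  then obtain k where "k \<in> H" "h = k \<or> h = X - k"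
    using assms(2) by (auto simp: halfspaces_def wall_of_def)
  then show "h \<subseteq> X" using H(1) by (auto simp: halfspace_collection_def)
  have "X - h \<in> wall_of X h" by (simp add: wall_of_def)
  then show "X - h \<in> halfspaces N" using 1 unfolding halfspaces_def by blast
qed

lemma wall_cases:
  assumes "measured_walls X N" "w \<in> space N"
  obtains h where "h \<in> halfspaces N" "X - h \<in> halfspaces N" "h \<subseteq> X" "w = {h, X - h}"
  using wall_of_surj[OF assms] halfspace_wall[OF assms(1)] that unfolding wall_of_def by metis

text \<open>The hypothesis \<open>X \<noteq> {}\<close> makes the two sides of a wall distinct.\<close>

lemma admissible_section_iff:
  assumes mw: "measured_walls X N" and "X \<noteq> {}"
  shows "admissible_section N \<sigma> \<longleftrightarrow> \<sigma> \<subseteq> halfspaces N \<and>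
    (\<forall>h\<in>halfspaces N. X - h \<in> \<sigma> \<longleftrightarrow> h \<notin> \<sigma>) \<and>
    (\<forall>h\<in>\<sigma>. \<forall>h'\<in>halfspaces N. h \<subseteq> h' \<longrightarrow> h' \<in> \<sigma>)"
proof -
  have ne: "h \<noteq> X - h" for h using \<open>X \<noteq> {}\<close> by blast
  have "(\<forall>w\<in>space N. \<exists>!h. h \<in> w \<and> h \<in> \<sigma>) \<longleftrightarrow> (\<forall>h\<in>halfspaces N. X - h \<in> \<sigma> \<longleftrightarrow> h \<notin> \<sigma>)"
  proof (rule iffI; intro ballI)
    fix h assume *: "\<forall>w\<in>space N. \<exists>!h. h \<in> w \<and> h \<in> \<sigma>" and h: "h \<in> halfspaces N"
    have "\<exists>!k. k \<in> {h, X - h} \<and> k \<in> \<sigma>"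
      using bspec[OF * halfspace_wall(3)[OF mw h]] by (simp only: wall_of_def)
    then show "X - h \<in> \<sigma> \<longleftrightarrow> h \<notin> \<sigma>" using ne[of h] by auto
  next
    fix w assume *: "\<forall>h\<in>halfspaces N. X - h \<in> \<sigma> \<longleftrightarrow> h \<notin> \<sigma>" and w: "w \<in> space N"
    obtain h where "h \<in> halfspaces N" "w = {h, X - h}" using wall_cases[OF mw w] .
    then show "\<exists>!h. h \<in> w \<and> h \<in> \<sigma>" using * by auto
  qed
  then show ?thesis by (simp add: admissible_section_def)
qed

lemma fmeasurable_sym_diff:
  assumes "A \<in> fmeasurable M" "B \<in> fmeasurable M"
  shows "sym_diff A B \<in> fmeasurable M"
  using assms by (simp add: fmeasurable.Diff fmeasurable.Un)

lemma sym_diff_trans: "sym_diff A C = sym_diff (sym_diff A B) (sym_diff B C)"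
  by blast

lemma point_section_diff:
  assumes mw: "measured_walls X N" and xy: "x \<in> X" "y \<in> X"
  shows "sym_diff (point_section N x) (point_section N y) =
    wall_of X -` walls_between X (space N) x y \<inter> halfspaces N"
proof -
  have sep: "separates X (wall_of X h) x y \<longleftrightarrow> (x \<in> h) \<noteq> (y \<in> h)" if "h \<in> halfspaces N" for h
    using separates_wall_of[OF halfspace_wall(1)[OF mw that] xy] .
  show ?thesis
    using sep halfspace_wall(3)[OF mw] by (auto simp: point_section_def walls_between_def)
qed

lemma fmeasurable_halfspace_iff:
  assumes mw: "measured_walls X N"
  shows "A \<in> fmeasurable (halfspace_measure X N) \<longleftrightarrow>
    (\<exists>B\<in>fmeasurable N. A = wall_of X -` B \<inter> halfspaces N)"
  using emeasure_halfspace_measure[OF mw] sets_halfspace_measure[OF mw]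
  by (auto simp: fmeasurable_def)

lemma between_fmeasurable:
  "measured_walls X N \<Longrightarrow> x \<in> X \<Longrightarrow> y \<in> X \<Longrightarrow> walls_between X (space N) x y \<in> fmeasurable N"
  by (auto simp: measured_walls_def fmeasurable_def)

lemma point_section_diff_fmeasurable:
  assumes mw: "measured_walls X N" and xy: "x \<in> X" "y \<in> X"
  shows "sym_diff (point_section N x) (point_section N y) \<in> fmeasurable (halfspace_measure X N)"
  unfolding fmeasurable_halfspace_iff[OF mw] point_section_diff[OF assms]
  using between_fmeasurable[OF assms] by blast

lemma section_space_iff:
  "\<sigma> \<in> section_space X N \<longleftrightarrow> admissible_section N \<sigma> \<and>
    (\<exists>x\<in>X. sym_diff \<sigma> (point_section N x) \<in> fmeasurable (halfspace_measure X N))"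
  by (auto simp: section_space_def fmeasurable_def)

lemma section_diff_fmeasurable:
  assumes mw: "measured_walls X N" and "\<sigma> \<in> section_space X N" "\<tau> \<in> section_space X N"
  shows "sym_diff \<sigma> \<tau> \<in> fmeasurable (halfspace_measure X N)"
proof -
  let ?F = "fmeasurable (halfspace_measure X N)" and ?p = "point_section N"
  obtain x y where xy: "x \<in> X" "y \<in> X" "sym_diff \<sigma> (?p x) \<in> ?F" "sym_diff \<tau> (?p y) \<in> ?F"
    using assms by (auto simp: section_space_iff)
  have "sym_diff (sym_diff (sym_diff \<sigma> (?p x)) (sym_diff (?p x) (?p y))) (sym_diff \<tau> (?p y)) \<in> ?F"
    by (intro fmeasurable_sym_diff xy point_section_diff_fmeasurable[OF mw])
  also have "sym_diff (sym_diff (sym_diff \<sigma> (?p x)) (sym_diff (?p x) (?p y))) (sym_diff \<tau> (?p y))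
      = sym_diff \<sigma> \<tau>" by blast
  finally show ?thesis .
qed

lemma section_spaceI:
  assumes mw: "measured_walls X N" and "admissible_section N \<sigma>" and \<tau>: "\<tau> \<in> section_space X N"
    and diff: "sym_diff \<sigma> \<tau> \<in> fmeasurable (halfspace_measure X N)"
  shows "\<sigma> \<in> section_space X N"
proof -
  obtain x where x: "x \<in> X"
    "sym_diff \<tau> (point_section N x) \<in> fmeasurable (halfspace_measure X N)"
    using \<tau> by (auto simp: section_space_iff)
  have "sym_diff \<sigma> (point_section N x) \<in> fmeasurable (halfspace_measure X N)"
    using fmeasurable_sym_diff[OF diff x(2)] by (simp only: sym_diff_trans[symmetric])
  then show ?thesis using assms(2) x(1) by (auto simp: section_space_iff)
qed

lemma point_section_in_section_space:
  assumes mw: "measured_walls X N" and x: "x \<in> X"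
  shows "point_section N x \<in> section_space X N"
proof -
  have "X \<noteq> {}" using x by blast
  then have "admissible_section N (point_section N x)"
    using halfspace_wall[OF mw] x
    by (auto simp: admissible_section_iff[OF mw] point_section_def)
  then show ?thesis
    unfolding section_space_iff using x point_section_diff_fmeasurable[OF mw x x] by blast
qed

lemma section_pdist_point_section:
  assumes mw: "measured_walls X N" and xy: "x \<in> X" "y \<in> X"
  shows "section_pdist X N (point_section N x) (point_section N y) = wall_pdist X N x y"
  using emeasure_halfspace_measure[OF mw, of "walls_between X (space N) x y"]
    between_fmeasurable[OF assms]
  by (simp add: section_pdist_def wall_pdist_def point_section_diff[OF assms] measure_def fmeasurable_def)

text \<open>The defect in the triangle inequality for symmetric differences: \<open>x\<close> is between \<open>a\<close> and
  \<open>b\<close> iff it differs from both only on a null set.\<close>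

lemma measure_sym_diff_Int:
  assumes "sym_diff a x \<in> fmeasurable M" "sym_diff x b \<in> fmeasurable M"
  shows "measure M (sym_diff a b) + 2 * measure M (sym_diff a x \<inter> sym_diff x b)
    = measure M (sym_diff a x) + measure M (sym_diff x b)"
proof -
  let ?A = "sym_diff a x" and ?B = "sym_diff x b"
  have "measure M (?A \<union> ?B) = measure M ?A + measure M ?B - measure M (?A \<inter> ?B)"
    using assms by (rule measure_Un3)
  moreover have "measure M (?A \<union> ?B) = measure M (sym_diff a b) + measure M (?A \<inter> ?B)"
  proof -
    have "?A \<union> ?B = sym_diff a b \<union> (?A \<inter> ?B)" by blast
    moreover have "sym_diff a b \<in> fmeasurable M"
      using fmeasurable_sym_diff[OF assms] by (simp only: sym_diff_trans[symmetric])
    moreover have "sym_diff a b \<inter> (?A \<inter> ?B) = {}" by blast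
    ultimately show ?thesis
      using measure_Un3[of "sym_diff a b" M "?A \<inter> ?B"] fmeasurable.Int[OF assms] by simp
  qed
  ultimately show ?thesis by linarith
qed

lemma pseudo_metric_section:
  assumes mw: "measured_walls X N"
  shows "pseudo_metric_on (section_space X N) (section_pdist X N)"
  unfolding pseudo_metric_on_def
proof (intro conjI ballI)
  note F = section_diff_fmeasurable[OF mw]
  fix a b assume ab: "a \<in> section_space X N" "b \<in> section_space X N"
  show "0 \<le> section_pdist X N a b" by (simp add: section_pdist_def)
  show "section_pdist X N a b = section_pdist X N b a" by (simp add: section_pdist_def Un_commute)
  fix c assume c: "c \<in> section_space X N"
  show "section_pdist X N a c \<le> section_pdist X N a b + section_pdist X N b c"
  proof -
    have "0 \<le> measure (halfspace_measure X N) (sym_diff a b \<inter> sym_diff b c)" by simp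
    then show ?thesis
      unfolding section_pdist_def
      using measure_sym_diff_Int[OF F[OF ab] F[OF ab(2) c]] by linarith
  qed
qed (simp add: section_pdist_def)

lemma null_sets_iff_measure_0:
  assumes "A \<in> fmeasurable M"
  shows "A \<in> null_sets M \<longleftrightarrow> measure M A = 0"
  using fmeasurableD[OF assms] emeasure_eq_measure2[OF assms] by (simp add: null_sets_def)

lemma median_pseudo_metric_section_space:
  assumes mw: "measured_walls X N"
  shows "median_pseudo_metric_space (section_space X N) (section_pdist X N)"
  unfolding median_pseudo_metric_space_def
proof (intro conjI ballI pseudo_metric_section[OF mw])
  let ?S = "section_space X N" and ?H = "halfspace_measure X N"
  note F = section_diff_fmeasurable[OF mw]
  have interval: "m \<in> metric_interval ?S (section_pdist X N) a b \<longleftrightarrow>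
      sym_diff a m \<inter> sym_diff m b \<in> null_sets ?H" if "m \<in> ?S" "a \<in> ?S" "b \<in> ?S" for m a b
  proof -
    have I: "sym_diff a m \<inter> sym_diff m b \<in> fmeasurable ?H" using F that by auto
    show ?thesis
      unfolding null_sets_iff_measure_0[OF I]
      using measure_sym_diff_Int[OF F[OF that(2,1)] F[OF that(1,3)]] that(1)
      by (auto simp: metric_interval_def section_pdist_def)
  qed
  fix a b c assume abc: "a \<in> ?S" "b \<in> ?S" "c \<in> ?S"
  have ne: "X \<noteq> {}" using abc(1) by (auto simp: section_space_iff)
  \<comment> \<open>The majority vote of the three sections.\<close>
  define m where "m = (a \<inter> b) \<union> (b \<inter> c) \<union> (a \<inter> c)"
  have "admissible_section N a" "admissible_section N b" "admissible_section N c"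
    using abc by (auto simp: section_space_iff)
  then have "admissible_section N m"
    unfolding admissible_section_iff[OF mw ne]
  proof (elim conjE, intro conjI ballI impI)
    assume sub: "a \<subseteq> halfspaces N" "b \<subseteq> halfspaces N" "c \<subseteq> halfspaces N"
      and compl: "\<forall>h\<in>halfspaces N. (X - h \<in> a) = (h \<notin> a)"
        "\<forall>h\<in>halfspaces N. (X - h \<in> b) = (h \<notin> b)"
        "\<forall>h\<in>halfspaces N. (X - h \<in> c) = (h \<notin> c)"
      and up: "\<forall>h\<in>a. \<forall>h'\<in>halfspaces N. h \<subseteq> h' \<longrightarrow> h' \<in> a"
        "\<forall>h\<in>b. \<forall>h'\<in>halfspaces N. h \<subseteq> h' \<longrightarrow> h' \<in> b"
        "\<forall>h\<in>c. \<forall>h'\<in>halfspaces N. h \<subseteq> h' \<longrightarrow> h' \<in> c"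
    show "m \<subseteq> halfspaces N" using sub by (auto simp: m_def)
    show "(X - h \<in> m) = (h \<notin> m)" if "h \<in> halfspaces N" for h
      using that compl by (simp add: m_def) blast
    show "h' \<in> m" if "h \<in> m" "h' \<in> halfspaces N" "h \<subseteq> h'" for h h'
    proof -
      have "h \<in> s \<Longrightarrow> h' \<in> s" if "s \<in> {a, b, c}" for s
        using up that \<open>h' \<in> halfspaces N\<close> \<open>h \<subseteq> h'\<close> by fast
      then show ?thesis using \<open>h \<in> m\<close> unfolding m_def by simp blast
    qed
  qed
  moreover have "sym_diff m a = sym_diff a b \<inter> sym_diff a c" by (auto simp: m_def)
  ultimately have m: "m \<in> ?S"
    using section_spaceI[OF mw _ abc(1)] fmeasurable.Int[OF F[OF abc(1,2)] F[OF abc(1,3)]] by simp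
  have "sym_diff a m \<inter> sym_diff m b = {}" "sym_diff b m \<inter> sym_diff m c = {}"
    "sym_diff a m \<inter> sym_diff m c = {}" by (auto simp: m_def)
  then have "m \<in> median_set ?S (section_pdist X N) a b c"
    unfolding median_set_def using interval m abc by simp
  then show "median_set ?S (section_pdist X N) a b c \<noteq> {}" by blast
  fix x y assume xy: "x \<in> median_set ?S (section_pdist X N) a b c"
    "y \<in> median_set ?S (section_pdist X N) a b c"
  have S: "x \<in> ?S" "y \<in> ?S" using xy by (auto simp: median_set_def metric_interval_def)
  \<comment> \<open>\<open>D z\<close> is where \<open>z\<close> disagrees with at least two of \<open>a\<close>, \<open>b\<close>, \<open>c\<close>.\<close>
  define D where "D z = (sym_diff a z \<inter> sym_diff z b) \<union> (sym_diff b z \<inter> sym_diff z c) \<union>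
    (sym_diff a z \<inter> sym_diff z c)" for z
  have "D x \<in> null_sets ?H" "D y \<in> null_sets ?H"
    using xy unfolding D_def median_set_def
    by (simp_all only: Int_iff interval[OF S(1)] interval[OF S(2)] abc null_sets.Un)
  then have "D x \<union> D y \<in> null_sets ?H" by (rule null_sets.Un)
  moreover have "sym_diff x y \<subseteq> D x \<union> D y" by (auto simp: D_def)
  ultimately have "sym_diff x y \<in> null_sets ?H"
    using null_sets_subset[OF _ fmeasurableD[OF F[OF S]]] by blast
  then show "section_pdist X N x y = 0" by (simp add: section_pdist_def measure_eq_0_null_sets)
qed

lemma isometric_embedding_point_section:
  assumes mw: "measured_walls X N"
  shows "isometric_embedding X (wall_pdist X N)
    (section_space X N) (section_pdist X N) (point_section N)"
  using point_section_in_section_space[OF mw] section_pdist_point_section[OF mw]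
  by (auto simp: isometric_embedding_def)

lemma pseudo_metric_wall_pdist:
  assumes mw: "measured_walls X N"
  shows "pseudo_metric_on X (wall_pdist X N)"
  using pseudo_metric_section[OF mw] point_section_in_section_space[OF mw]
  by (simp add: pseudo_metric_on_def section_pdist_point_section[OF mw, symmetric])

lemma pullback_wall_of:
  assumes "\<phi> \<in> X \<rightarrow> X'" "h \<subseteq> X'"
  shows "wall_pullback X \<phi> (wall_of X' h) = wall_of X (\<phi> -` h \<inter> X)"
proof -
  have "\<phi> -` (X' - h) \<inter> X = X - (\<phi> -` h \<inter> X)" using assms by auto
  then show ?thesis by (simp add: wall_pullback_def wall_of_def)
qed

lemma isometric_embedding_induced_section_map:
  assumes mw: "measured_walls X N" and mw': "measured_walls X' N'"
    and hom: "wall_hom X N X' N' \<phi>"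
  shows "isometric_embedding (section_space X N) (section_pdist X N)
    (section_space X' N') (section_pdist X' N') (induced_section_map X N' \<phi>)"
proof -
  let ?f = "induced_section_map X N' \<phi>" and ?p = "wall_pullback X \<phi>"
  have \<phi>: "\<phi> \<in> X \<rightarrow> X'" using hom by (simp add: wall_hom_def)
  have pull: "wall_of X (\<phi> -` h \<inter> X) \<in> space N" "\<phi> -` h \<inter> X \<in> halfspaces N"
    if "h \<in> halfspaces N'" for h
  proof -
    show "wall_of X (\<phi> -` h \<inter> X) \<in> space N"
      using hom halfspace_wall[OF mw' that] pullback_wall_of[OF \<phi>] unfolding wall_hom_def by metis
    then show "\<phi> -` h \<inter> X \<in> halfspaces N" by (auto simp: halfspaces_def wall_of_def)
  qed
  have diff: "sym_diff (?f \<sigma>) (?f \<tau>) = wall_of X' -` (?p -` B \<inter> space N') \<inter> halfspaces N'"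
    if B: "sym_diff \<sigma> \<tau> = wall_of X -` B \<inter> halfspaces N" for \<sigma> \<tau> B
  proof -
    have "h \<in> sym_diff (?f \<sigma>) (?f \<tau>) \<longleftrightarrow> \<phi> -` h \<inter> X \<in> sym_diff \<sigma> \<tau>"
      if "h \<in> halfspaces N'" for h using that by (auto simp: induced_section_map_def)
    moreover have "\<phi> -` h \<inter> X \<in> sym_diff \<sigma> \<tau> \<longleftrightarrow> ?p (wall_of X' h) \<in> B"
      if "h \<in> halfspaces N'" for h
      unfolding B using pull(2)[OF that] pullback_wall_of[OF \<phi> halfspace_wall(1)[OF mw' that]] by simp
    ultimately show ?thesis
      using halfspace_wall(3)[OF mw'] by (auto simp: induced_section_map_def)
  qed
  have meas: "sym_diff (?f \<sigma>) (?f \<tau>) \<in> fmeasurable (halfspace_measure X' N') \<and>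
      measure (halfspace_measure X' N') (sym_diff (?f \<sigma>) (?f \<tau>)) =
      measure (halfspace_measure X N) (sym_diff \<sigma> \<tau>)"
    if F: "sym_diff \<sigma> \<tau> \<in> fmeasurable (halfspace_measure X N)" for \<sigma> \<tau>
  proof -
    obtain B where B: "B \<in> fmeasurable N" "sym_diff \<sigma> \<tau> = wall_of X -` B \<inter> halfspaces N"
      using F fmeasurable_halfspace_iff[OF mw] by blast
    let ?B = "?p -` B \<inter> space N'"
    have B': "?B \<in> sets N'" "emeasure N' ?B = emeasure N B"
      using hom fmeasurableD[OF B(1)] by (auto simp: wall_hom_def)
    then have "?B \<in> fmeasurable N'" using B(1) by (simp add: fmeasurable_def)
    then have "sym_diff (?f \<sigma>) (?f \<tau>) \<in> fmeasurable (halfspace_measure X' N')"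
      unfolding fmeasurable_halfspace_iff[OF mw'] using diff[OF B(2)] by blast
    moreover have "emeasure (halfspace_measure X' N') (sym_diff (?f \<sigma>) (?f \<tau>)) =
        emeasure (halfspace_measure X N) (sym_diff \<sigma> \<tau>)"
      unfolding diff[OF B(2)] unfolding B(2)
      by (simp only: emeasure_halfspace_measure[OF mw' B'(1)] B'(2)
          emeasure_halfspace_measure[OF mw fmeasurableD[OF B(1)]])
    ultimately show ?thesis by (simp only: measure_def)
  qed
  have point: "?f (point_section N x) = point_section N' (\<phi> x)" if "x \<in> X" for x
    using that pull(2) by (auto simp: induced_section_map_def point_section_def)
  have "?f \<sigma> \<in> section_space X' N'" if \<sigma>: "\<sigma> \<in> section_space X N" for \<sigma>
  proof -
    obtain x where x: "x \<in> X" using \<sigma> by (auto simp: section_space_iff)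
    have ne: "X \<noteq> {}" "X' \<noteq> {}" using x \<phi> by auto
    have adm: "admissible_section N \<sigma>" using \<sigma> by (simp add: section_space_iff)
    have "admissible_section N' (?f \<sigma>)"
      unfolding admissible_section_iff[OF mw' ne(2)]
    proof (intro conjI ballI impI)
      show "?f \<sigma> \<subseteq> halfspaces N'" by (auto simp: induced_section_map_def)
      fix h assume h: "h \<in> halfspaces N'"
      have "\<phi> -` (X' - h) \<inter> X = X - (\<phi> -` h \<inter> X)" using \<phi> by auto
      then show "X' - h \<in> ?f \<sigma> \<longleftrightarrow> h \<notin> ?f \<sigma>"
        using adm pull(2)[OF h] halfspace_wall(2)[OF mw' h] h
        by (simp add: induced_section_map_def admissible_section_iff[OF mw ne(1)])
    next
      fix h h' assume h: "h \<in> ?f \<sigma>" "h' \<in> halfspaces N'" "h \<subseteq> h'"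
      then have "\<phi> -` h \<inter> X \<in> \<sigma>" "\<phi> -` h \<inter> X \<subseteq> \<phi> -` h' \<inter> X" by (auto simp: induced_section_map_def)
      then have "\<phi> -` h' \<inter> X \<in> \<sigma>"
        using adm pull(2)[OF h(2)] by (auto simp: admissible_section_def)
      then show "h' \<in> ?f \<sigma>" using h by (simp add: induced_section_map_def)
    qed
    moreover have "sym_diff (?f \<sigma>) (point_section N' (\<phi> x)) \<in> fmeasurable (halfspace_measure X' N')"
      using meas[OF section_diff_fmeasurable[OF mw \<sigma> point_section_in_section_space[OF mw x]]]
      by (simp add: point[OF x])
    ultimately show ?thesis using x \<phi> by (auto simp: section_space_iff)
  qed
  moreover have "section_pdist X' N' (?f \<sigma>) (?f \<tau>) = section_pdist X N \<sigma> \<tau>"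
    if "\<sigma> \<in> section_space X N" "\<tau> \<in> section_space X N" for \<sigma> \<tau>
    using meas[OF section_diff_fmeasurable[OF mw that]] by (simp add: section_pdist_def)
  ultimately show ?thesis by (auto simp: isometric_embedding_def)
qed

section \<open>Intervals and medians\<close>

text \<open>Median spaces as a locale extending metric spaces; \<open>median_metric_iff\<close> below identifies it
  with \<open>median_space\<close>.\<close>

locale median_metric = Metric_space X d for X :: "'a set" and d +
  assumes median_set_singleton:
    "\<And>a b c. a \<in> X \<Longrightarrow> b \<in> X \<Longrightarrow> c \<in> X \<Longrightarrow> \<exists>m. median_set X d a b c = {m}"
begin

abbreviation I :: "'a \<Rightarrow> 'a \<Rightarrow> 'a set" where
  "I \<equiv> metric_interval X d"

text \<open>The unique point of the median set; meaningful only for arguments in \<open>X\<close>.\<close>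

definition med :: "'a \<Rightarrow> 'a \<Rightarrow> 'a \<Rightarrow> 'a" where
  "med a b c = (THE m. median_set X d a b c = {m})"

lemma interval_iff: "x \<in> I a b \<longleftrightarrow> x \<in> X \<and> d a x + d x b = d a b"
  by (simp add: metric_interval_def)

lemma interval_commute: "I a b = I b a"
  by (auto simp: interval_iff commute add.commute)

lemma interval_in_space: "x \<in> I a b \<Longrightarrow> x \<in> X"
  by (simp add: interval_iff)

lemma left_in_interval: "a \<in> X \<Longrightarrow> b \<in> X \<Longrightarrow> a \<in> I a b"
  and right_in_interval: "a \<in> X \<Longrightarrow> b \<in> X \<Longrightarrow> b \<in> I a b"
  by (simp_all add: interval_iff)

lemma interval_self: "a \<in> X \<Longrightarrow> I a a = {a}"
proof -
  assume a: "a \<in> X"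
  have "x = a" if "x \<in> I a a" for x
  proof -
    have x: "x \<in> X" "d a x + d x a = d a a" using that by (auto simp: interval_iff)
    have "d a a = 0" using a by simp
    then have "d a x = 0" using x(2) nonneg[of a x] nonneg[of x a] by linarith
    then show ?thesis using a x(1) by simp
  qed
  then show ?thesis using left_in_interval[OF a a] by blast
qed

text \<open>Both this lemma and the next say that \<open>a, x, y, c\<close> are aligned in this order, starting from
  two of the betweenness relations involved.\<close>

lemma interval_chain:
  assumes "a \<in> X" "c \<in> X" "y \<in> I a c" "x \<in> I a y"
  shows "x \<in> I a c" "y \<in> I x c"
  using assms triangle[of x y c] triangle[of a x c] by (auto simp: interval_iff)

lemma interval_chain':
  assumes "a \<in> X" "c \<in> X" "x \<in> I a c" "y \<in> I x c"
  shows "y \<in> I a c" "x \<in> I a y"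
  using assms interval_chain[of c a x y] by (simp_all add: interval_commute)

lemma
  assumes "a \<in> X" "b \<in> X" "c \<in> X"
  shows med_in1: "med a b c \<in> I a b" and med_in2: "med a b c \<in> I b c"
    and med_in3: "med a b c \<in> I a c" and med_in_space: "med a b c \<in> X"
    and med_unique: "\<And>m. m \<in> I a b \<Longrightarrow> m \<in> I b c \<Longrightarrow> m \<in> I a c \<Longrightarrow> m = med a b c"
proof -
  obtain m where m: "median_set X d a b c = {m}"
    using median_set_singleton[OF assms] by blast
  then have [simp]: "med a b c = m" by (simp add: med_def)
  have "m \<in> median_set X d a b c" using m by simp
  then show "med a b c \<in> I a b" "med a b c \<in> I b c" "med a b c \<in> I a c" "med a b c \<in> X"
    by (auto simp: median_set_def interval_iff)
  fix k assume "k \<in> I a b" "k \<in> I b c" "k \<in> I a c"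
  then have "k \<in> median_set X d a b c" by (simp add: median_set_def)
  then show "k = med a b c" using m by simp
qed

text \<open>\<open>med x y a\<close> is the gate of \<open>a\<close> in the interval from \<open>x\<close> to \<open>y\<close>: it is between \<open>a\<close> and every
  point of that interval.\<close>

lemma gate:
  assumes X: "x \<in> X" "y \<in> X" "a \<in> X" and z: "z \<in> I x y"
  shows "med x y a \<in> I a z"
proof -
  have zX: "z \<in> X" using z by (rule interval_in_space)
  define u where "u = med x a z"
  define v where "v = med y a z"
  define p where "p = med u v a"
  have uX: "u \<in> X" and vX: "v \<in> X" unfolding u_def v_def by (simp_all add: med_in_space X zX)
  have pX: "p \<in> X" unfolding p_def by (simp add: med_in_space X uX vX)
  have u: "u \<in> I x a" "u \<in> I a z" "u \<in> I x z"
    unfolding u_def using X zX by (simp_all add: med_in1 med_in2 med_in3)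
  have v: "v \<in> I y a" "v \<in> I a z" "v \<in> I y z"
    unfolding v_def using X zX by (simp_all add: med_in1 med_in2 med_in3)
  have p: "p \<in> I u v" "p \<in> I v a" "p \<in> I u a"
    unfolding p_def using X uX vX by (simp_all add: med_in1 med_in2 med_in3)
  have "z \<in> I u y" "u \<in> I x y" using interval_chain[of x y z u] X z u by auto
  moreover have "v \<in> I z y" using v(3) by (simp add: interval_commute)
  ultimately have "v \<in> I u y" using interval_chain'(1)[of u y z v] uX X by auto
  then have "p \<in> I u y" using interval_chain(1)[of u y v p] uX X p(1) by auto
  then have 1: "p \<in> I x y" using interval_chain'(1)[of x y u p] X \<open>u \<in> I x y\<close> by auto
  have 2: "p \<in> I x a" using interval_chain'(1)[of x a u p] X u(1) p(3) by auto
  have 3: "p \<in> I y a" using interval_chain'(1)[of y a v p] X v(1) p(2) by auto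
  \<comment> \<open>\<open>p\<close> was constructed between \<open>a\<close> and \<open>u\<close>, with \<open>u\<close> between \<open>a\<close> and \<open>z\<close>;
    uniqueness of the median now identifies it with \<open>med x y a\<close>.\<close>
  have "p = med x y a" using med_unique[of x y a p] X 1 2 3 by auto
  moreover have "p \<in> I a z"
    using interval_chain(1)[of a z u p] X zX u(2) p(3) by (simp add: interval_commute)
  ultimately show ?thesis by simp
qed

lemma med_lipschitz:
  assumes X: "x \<in> X" "y \<in> X" "a \<in> X" "b \<in> X"
  shows "d (med x y a) (med x y b) \<le> d a b"
proof -
  define p where "p = med x y a"
  define q where "q = med x y b"
  have pX: "p \<in> X" "q \<in> X" "p \<in> I x y" "q \<in> I x y"
    unfolding p_def q_def using X by (simp_all add: med_in_space med_in1)
  have "p \<in> I a q" "q \<in> I b p"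
    using gate[of x y a q] gate[of x y b p] X pX unfolding p_def q_def by auto
  then have "d a p + d p q = d a q" "d b q + d q p = d b p" by (auto simp: interval_iff)
  moreover have "d a q \<le> d a b + d b q" "d b p \<le> d b a + d a p"
    using X pX by (auto intro!: triangle)
  ultimately show ?thesis unfolding p_def q_def using commute by (smt (verit))
qed

text \<open>For fixed \<open>g\<close> and \<open>r\<close>, the points \<open>p\<close> such that \<open>g\<close> is between \<open>r\<close> and \<open>p\<close> form a convex
  set.\<close>

lemma convex_beyond:
  assumes X: "g \<in> X" "r \<in> X" "u \<in> X" "v \<in> X"
    and g: "g \<in> I r u" "g \<in> I r v" and p: "p \<in> I u v"
  shows "g \<in> I r p"
proof -
  have pX: "p \<in> X" using p by (rule interval_in_space)
  define e where "e = med u v g"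
  have eX: "e \<in> X" unfolding e_def by (simp add: X med_in_space)
  have e: "e \<in> I u v" "e \<in> I g u" "e \<in> I g v"
    unfolding e_def using med_in1[of u v g] med_in2[of u v g] med_in3[of u v g] X
    by (simp_all add: interval_commute)
  \<comment> \<open>\<open>e\<close> is at once the gate of \<open>g\<close> and the gate of \<open>r\<close> in the interval from \<open>u\<close> to
    \<open>v\<close>.\<close>
  have "e \<in> I r u" "g \<in> I r e" using interval_chain'[of r u g e] X g e by auto
  moreover have "e \<in> I r v" using interval_chain'[of r v g e] X g e by auto
  ultimately have "e = med u v r"
    using med_unique[of u v r e] X e by (simp add: interval_commute)
  then have "e \<in> I r p" using gate[of u v r p] X p by simp
  then show ?thesis using interval_chain(1)[of r p e g] X pX \<open>g \<in> I r e\<close> by simp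
qed

section \<open>Convex half-spaces and separation\<close>

abbreviation "mconvex \<equiv> median_convex X d"

lemma mconvexD: "mconvex A \<Longrightarrow> a \<in> A \<Longrightarrow> b \<in> A \<Longrightarrow> c \<in> I a b \<Longrightarrow> c \<in> A"
  by (auto simp: median_convex_def)

text \<open>For \<open>r\<close> between \<open>p\<close> and \<open>q\<close>, which lie between \<open>u, v \<in> A\<close> and \<open>z\<close>, the point
  \<open>w = med u v r\<close> belongs to \<open>A\<close>, and \<open>r\<close> is between \<open>w\<close> and \<open>z\<close>.\<close>

lemma join_convex:
  assumes A: "mconvex A" and z: "z \<in> X"
  shows "mconvex (\<Union>u\<in>A. I u z)"
  unfolding median_convex_def
proof (intro conjI ballI subsetI)
  have AX: "A \<subseteq> X" using A by (simp add: median_convex_def)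
  show "x \<in> X" if "x \<in> (\<Union>u\<in>A. I u z)" for x using that interval_in_space by blast
  fix p q r assume "p \<in> (\<Union>u\<in>A. I u z)" "q \<in> (\<Union>u\<in>A. I u z)" and r: "r \<in> I p q"
  then obtain u v where uv: "u \<in> A" "v \<in> A" "p \<in> I u z" "q \<in> I v z" by blast
  have X: "u \<in> X" "v \<in> X" "p \<in> X" "q \<in> X" "r \<in> X"
    using uv AX r interval_in_space by auto
  define w where "w = med u v r"
  have w: "w \<in> I u v" "w \<in> I r u" "w \<in> I r v" "w \<in> X"
    unfolding w_def using X med_in1[of u v r] med_in2[of u v r] med_in3[of u v r]
    by (simp_all add: interval_commute med_in_space)
  have wA: "w \<in> A" using mconvexD[OF A uv(1,2) w(1)] .
  define g where "g = med r w z"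
  have g: "g \<in> I r w" "g \<in> I w z" "g \<in> I r z" "g \<in> X"
    unfolding g_def using X w z by (simp_all add: med_in_space med_in1 med_in2 med_in3)
  have "g \<in> I r u" using interval_chain(1)[of r u w g] X w g by simp
  then have p: "g \<in> I r p" using convex_beyond[of g r u z p] X g z uv by simp
  have "g \<in> I r v" using interval_chain(1)[of r v w g] X w g by simp
  then have q: "g \<in> I r q" using convex_beyond[of g r v z q] X g z uv by simp
  \<comment> \<open>Both \<open>p\<close> and \<open>q\<close> lie beyond \<open>g\<close> as seen from \<open>r\<close>, so passing from \<open>p\<close> to \<open>q\<close>
    via \<open>r\<close> would backtrack along the segment from \<open>g\<close> to \<open>r\<close>.\<close>
  have "d p q = d p r + d r q" using r by (simp add: interval_iff)
  moreover have "d r g + d g p = d r p" "d r g + d g q = d r q"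
    using p q by (simp_all add: interval_iff)
  moreover have "d p q \<le> d p g + d g q" using X g by (simp add: triangle)
  moreover have "d p r = d r p" "d p g = d g p" by (simp_all add: commute)
  ultimately have "d r g \<le> 0" by linarith
  then have "d r g = 0" using nonneg[of r g] by linarith
  then have "r = g" using X g by simp
  then show "r \<in> (\<Union>u\<in>A. I u z)" using g(2) wA by blast
qed

text \<open>The sides of the convex walls; the empty set and \<open>X\<close> are included.\<close>

definition halfspace :: "'a set \<Rightarrow> bool" where
  "halfspace h \<longleftrightarrow> mconvex h \<and> mconvex (X - h)"

lemma halfspace_subset: "halfspace h \<Longrightarrow> h \<subseteq> X"
  by (simp add: halfspace_def median_convex_def)

lemma halfspace_compl: "halfspace h \<Longrightarrow> halfspace (X - h)"
  using halfspace_subset[of h] by (simp add: halfspace_def double_diff)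

lemma halfspace_in: "halfspace h \<Longrightarrow> u \<in> h \<Longrightarrow> v \<in> h \<Longrightarrow> w \<in> I u v \<Longrightarrow> w \<in> h"
  unfolding halfspace_def using mconvexD by blast

lemma halfspace_out:
  assumes "halfspace h" "u \<in> X" "v \<in> X" "u \<notin> h" "v \<notin> h" "w \<in> I u v"
  shows "w \<notin> h"
  using assms mconvexD[of "X - h" u v w] unfolding halfspace_def by auto

text \<open>A convex set that is maximal among those containing \<open>x\<close> but not \<open>y\<close> has a convex
  complement.\<close>

lemma separation:
  assumes x: "x \<in> X" and y: "y \<in> X" and "x \<noteq> y"
  shows "\<exists>h. halfspace h \<and> x \<in> h \<and> y \<notin> h"
proof -
  define C where "C = {h. mconvex h \<and> x \<in> h \<and> y \<notin> h}"
  have "{x} \<in> C"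
    unfolding C_def median_convex_def using assms by (auto simp: interval_self)
  then have "C \<noteq> {}" by blast
  moreover have "\<Union>K \<in> C" if "K \<noteq> {}" "subset.chain C K" for K
  proof -
    have K: "K \<subseteq> C" "\<And>A B. A \<in> K \<Longrightarrow> B \<in> K \<Longrightarrow> A \<subseteq> B \<or> B \<subseteq> A"
      using that(2) by (auto simp: subset_chain_def)
    have "mconvex (\<Union>K)"
      unfolding median_convex_def
    proof (intro conjI ballI subsetI)
      show "z \<in> X" if "z \<in> \<Union>K" for z
        using that K(1) by (auto simp: C_def median_convex_def)
      fix a b z assume "a \<in> \<Union>K" "b \<in> \<Union>K" and z: "z \<in> I a b"
      then obtain A where "A \<in> K" "a \<in> A" "b \<in> A" using K(2) by blast
      moreover have "mconvex A" using \<open>A \<in> K\<close> K(1) by (auto simp: C_def)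
      ultimately show "z \<in> \<Union>K" using mconvexD z by blast
    qed
    then show ?thesis using K(1) that(1) by (auto simp: C_def)
  qed
  ultimately obtain h where hC: "h \<in> C" and max: "\<And>k. k \<in> C \<Longrightarrow> h \<subseteq> k \<Longrightarrow> k = h"
    using subset_Zorn_nonempty[of C] by blast
  have h: "mconvex h" "x \<in> h" "y \<notin> h" "h \<subseteq> X"
    using hC by (auto simp: C_def median_convex_def)
  \<comment> \<open>By maximality the join of \<open>h\<close> with any further point contains \<open>y\<close>.\<close>
  have reach: "\<exists>u\<in>h. y \<in> I u a" if a: "a \<in> X" "a \<notin> h" for a
  proof (rule ccontr)
    assume no: "\<not> ?thesis"
    let ?J = "\<Union>u\<in>h. I u a"
    have "h \<subseteq> ?J" "a \<in> ?J"
      using h a left_in_interval right_in_interval by blast+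
    moreover have "?J \<in> C"
      using join_convex[OF h(1) a(1)] no \<open>h \<subseteq> ?J\<close> h(2) by (auto simp: C_def)
    ultimately show False using max a(2) by blast
  qed
  have "mconvex (X - h)"
    unfolding median_convex_def
  proof (intro conjI ballI subsetI)
    fix a b c assume ab: "a \<in> X - h" "b \<in> X - h" and c: "c \<in> I a b"
    have cX: "c \<in> X" using c by (rule interval_in_space)
    show "c \<in> X - h"
    proof (rule ccontr)
      assume "c \<notin> X - h"
      then have ch: "c \<in> h" using cX by blast
      obtain u v where uv: "u \<in> h" "v \<in> h" "y \<in> I u a" "y \<in> I v b"
        using reach ab by blast
      have X: "a \<in> X" "b \<in> X" "u \<in> X" "v \<in> X" using ab uv h by auto
      \<comment> \<open>\<open>s\<close> and \<open>t\<close> are points of \<open>h\<close>, and \<open>y\<close> turns out to be between them.\<close>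
      define s where "s = med u c y"
      define t where "t = med v c y"
      define r where "r = med s t y"
      have s: "s \<in> X" "s \<in> I u c" "s \<in> I y c" "s \<in> I u y"
        unfolding s_def using X cX y med_in1[of u c y] med_in2[of u c y] med_in3[of u c y]
        by (simp_all add: med_in_space interval_commute)
      have t: "t \<in> X" "t \<in> I v c" "t \<in> I y c" "t \<in> I v y"
        unfolding t_def using X cX y med_in1[of v c y] med_in2[of v c y] med_in3[of v c y]
        by (simp_all add: med_in_space interval_commute)
      have sh: "s \<in> h" "t \<in> h" using mconvexD[OF h(1)] uv ch s t by blast+
      have r: "r \<in> X" "r \<in> I s t" "r \<in> I t y" "r \<in> I s y"
        unfolding r_def using s t y by (simp_all add: med_in_space med_in1 med_in2 med_in3)
      have "y \<in> I s a" using interval_chain(2)[of u a y s] X uv s by simp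
      then have ya: "y \<in> I r a" using interval_chain(2)[of s a y r] X s r by simp
      have "y \<in> I t b" using interval_chain(2)[of v b y t] X uv t by simp
      then have yb: "y \<in> I r b" using interval_chain(2)[of t b y r] X t r by simp
      have yc: "y \<in> I r c" using convex_beyond[of y r a b c] X y r ya yb c by simp
      \<comment> \<open>\<open>y\<close> is between \<open>r\<close> and \<open>c\<close>, while \<open>r\<close> is between \<open>y\<close> and \<open>c\<close>.\<close>
      have "r \<in> I y c" using interval_chain(1)[of y c s r] y cX s r by (simp add: interval_commute)
      then have "d y r + d r c = d y c" "d r y + d y c = d r c"
        using yc by (simp_all add: interval_iff)
      then have "d y r = 0" using commute[of y r] by linarith
      then have "r = y" using y r by simp
      then have "y \<in> h" using mconvexD[OF h(1) sh r(2)] by simp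
      then show False using h by simp
    qed
  qed auto
  then have "halfspace h" using h by (simp add: halfspace_def)
  then show ?thesis using h by blast
qed

section \<open>Finite covers\<close>

text \<open>Subadditivity of the distance, for pairs that cover with orientation: a half-space with \<open>x\<close>
  inside and \<open>y\<close> outside has some \<open>s i\<close> inside and \<open>t i\<close> outside.\<close>

lemma dist_le_sum_finite_oriented:
  assumes "finite J" "x \<in> X" "y \<in> X" "\<And>i. i \<in> J \<Longrightarrow> s i \<in> X \<and> t i \<in> X"
    and "\<And>h. halfspace h \<Longrightarrow> x \<in> h \<Longrightarrow> y \<notin> h \<Longrightarrow> \<exists>i\<in>J. s i \<in> h \<and> t i \<notin> h"
  shows "d x y \<le> (\<Sum>i\<in>J. d (s i) (t i))"
  using assms
proof (induction J arbitrary: x y s t rule: finite_induct)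
  case empty
  then have "x = y" using separation[of x y] by blast
  then show ?case using empty by simp
next
  case (insert j J)
  note X = \<open>x \<in> X\<close> \<open>y \<in> X\<close>
  define a where "a = s j"
  define b where "b = t j"
  have ab: "a \<in> X" "b \<in> X" using insert.prems(3) by (auto simp: a_def b_def)
  have st: "s i \<in> X" "t i \<in> X" if "i \<in> J" for i using insert.prems(3) that by auto
  \<comment> \<open>\<open>x, q, b', y\<close> are aligned in this order. The pair \<open>(a, b)\<close> pays for the segment
    from \<open>q\<close> to \<open>b'\<close> and is not needed for the other two.\<close>
  define b' where "b' = med x y b"
  define q where "q = med x b' a"
  have b': "b' \<in> X" "b' \<in> I x y" "b' \<in> I y b" "b' \<in> I x b"
    unfolding b'_def using X ab by (simp_all add: med_in_space med_in1 med_in2 med_in3)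
  have q: "q \<in> X" "q \<in> I x b'" "q \<in> I b' a" "q \<in> I x a"
    unfolding q_def using X b' ab by (simp_all add: med_in_space med_in1 med_in2 med_in3)
  have qxy: "q \<in> I x y" using interval_chain(1)[of x y b' q] X b' q by simp
  have "b' = med x b' b"
    using med_unique[of x b' b b'] X b' ab by (simp add: right_in_interval left_in_interval)
  then have qb: "d q b' \<le> d a b"
    using med_lipschitz[of x b' a b] X b' ab by (simp add: q_def)
  \<comment> \<open>The pair \<open>(s i, m i)\<close> serves the segment from \<open>x\<close> to \<open>q\<close>, and \<open>(m i, t i)\<close> serves the
    one from \<open>b'\<close> to \<open>y\<close>.\<close>
  define m where "m i = med q (s i) (t i)" for i
  have m: "m i \<in> X" "m i \<in> I q (s i)" "m i \<in> I (s i) (t i)" "m i \<in> I q (t i)" if "i \<in> J" for i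
    unfolding m_def using q(1) st[OF that] by (simp_all add: med_in_space med_in1 med_in2 med_in3)
  have 1: "d x q \<le> (\<Sum>i\<in>J. d (s i) (m i))"
  proof (rule insert.IH)
    fix h assume h: "halfspace h" "x \<in> h" "q \<notin> h"
    have "y \<notin> h" using halfspace_in[OF h(1,2) _ qxy] h(3) by blast
    then obtain i where i: "i \<in> insert j J" "s i \<in> h" "t i \<notin> h"
      using insert.prems(4)[OF h(1,2)] by blast
    have "a \<notin> h" using halfspace_in[OF h(1,2) _ q(4)] h(3) by blast
    then have iJ: "i \<in> J" using i by (auto simp: a_def)
    have "m i \<notin> h" using halfspace_out[OF h(1) q(1) st(2)[OF iJ] h(3) i(3) m(4)[OF iJ]] .
    then show "\<exists>i\<in>J. s i \<in> h \<and> m i \<notin> h" using i iJ by blast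
  qed (use X q st m in auto)
  have 2: "d b' y \<le> (\<Sum>i\<in>J. d (m i) (t i))"
  proof (rule insert.IH)
    fix h assume h: "halfspace h" "b' \<in> h" "y \<notin> h"
    have xh: "x \<in> h" using halfspace_out[OF h(1) X _ h(3) b'(2)] h(2) by blast
    then obtain i where i: "i \<in> insert j J" "s i \<in> h" "t i \<notin> h"
      using insert.prems(4)[OF h(1)] h(3) by blast
    have "b \<in> h" using halfspace_out[OF h(1) X(2) ab(2) h(3) _ b'(3)] h(2) by blast
    then have iJ: "i \<in> J" using i by (auto simp: b_def)
    have "q \<in> h" using halfspace_in[OF h(1) xh h(2) q(2)] .
    then have "m i \<in> h" using halfspace_in[OF h(1) _ i(2) m(2)[OF iJ]] by blast
    then show "\<exists>i\<in>J. m i \<in> h \<and> t i \<notin> h" using i iJ by blast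
  qed (use X b' st m in auto)
  have "d x y = d x q + d q b' + d b' y" using b'(2) q(2) by (simp add: interval_iff)
  also have "\<dots> \<le> (\<Sum>i\<in>J. d (s i) (m i)) + d a b + (\<Sum>i\<in>J. d (m i) (t i))"
    using 1 2 qb by linarith
  also have "\<dots> = d a b + (\<Sum>i\<in>J. d (s i) (m i) + d (m i) (t i))"
    by (simp add: sum.distrib)
  also have "(\<Sum>i\<in>J. d (s i) (m i) + d (m i) (t i)) = (\<Sum>i\<in>J. d (s i) (t i))"
    using m(3) by (intro sum.cong) (auto simp: interval_iff)
  finally show ?case using insert.hyps by (simp add: a_def b_def)
qed

text \<open>The same without orientation. If a half-space with \<open>x\<close> inside and \<open>y\<close> outside separates
  \<open>s i\<close> and \<open>t i\<close>, then, in this orientation, it separates \<open>q i\<close> from one of the projections \<open>a i\<close>,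
  \<open>b i\<close> to the interval from \<open>x\<close> to \<open>y\<close>. Replacing the pair by \<open>(q i, a i)\<close> and \<open>(q i, b i)\<close> costs
  nothing, since \<open>q i\<close> is between the projections and projecting is 1-Lipschitz; a direct use of both \<open>(s i, t i)\<close> and
  \<open>(t i, s i)\<close> would lose a factor of \<open>2\<close>.\<close>

lemma dist_le_sum_finite:
  assumes "finite J" and X: "x \<in> X" "y \<in> X" and st: "\<And>i. i \<in> J \<Longrightarrow> s i \<in> X \<and> t i \<in> X"
    and cov: "\<And>h. halfspace h \<Longrightarrow> x \<in> h \<Longrightarrow> y \<notin> h \<Longrightarrow> \<exists>i\<in>J. (s i \<in> h) \<noteq> (t i \<in> h)"
  shows "d x y \<le> (\<Sum>i\<in>J. d (s i) (t i))"
proof -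
  define a where "a i = med x y (s i)" for i
  define b where "b i = med x y (t i)" for i
  define q where "q i = med (a i) (b i) x" for i
  have a: "a i \<in> X" "a i \<in> I x (s i)" "a i \<in> I y (s i)" if "i \<in> J" for i
    unfolding a_def using X st[OF that] by (simp_all add: med_in_space med_in2 med_in3)
  have b: "b i \<in> X" "b i \<in> I x (t i)" "b i \<in> I y (t i)" if "i \<in> J" for i
    unfolding b_def using X st[OF that] by (simp_all add: med_in_space med_in2 med_in3)
  have q: "q i \<in> X" "q i \<in> I (a i) (b i)" "q i \<in> I (a i) x" "q i \<in> I (b i) x" if "i \<in> J" for i
    unfolding q_def using X a(1)[OF that] b(1)[OF that]
    by (simp_all add: med_in_space med_in1 med_in2 med_in3)
  have "d x y \<le> (\<Sum>(i, l)\<in>J \<times> (UNIV :: bool set). d (q i) (if l then a i else b i))"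
  proof -
    have "d x y \<le> (\<Sum>k\<in>J \<times> (UNIV :: bool set).
        d (q (fst k)) (if snd k then a (fst k) else b (fst k)))"
    proof (rule dist_le_sum_finite_oriented)
      fix h assume h: "halfspace h" "x \<in> h" "y \<notin> h"
      obtain i where i: "i \<in> J" "(s i \<in> h) \<noteq> (t i \<in> h)" using cov[OF h] by blast
      have si: "s i \<in> X" "t i \<in> X" using st i by auto
      show "\<exists>k\<in>J \<times> (UNIV :: bool set).
          q (fst k) \<in> h \<and> (if snd k then a (fst k) else b (fst k)) \<notin> h"
      proof (cases "s i \<in> h")
        case True
        then have "a i \<in> h" using halfspace_in h a i by blast
        then have "q i \<in> h" using halfspace_in h q i by blast
        moreover have "b i \<notin> h" using halfspace_out[of h y "t i" "b i"] h b X si i True by blast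
        ultimately show ?thesis using i by (intro bexI[of _ "(i, False)"]) auto
      next
        case False
        then have "b i \<in> h" using halfspace_in h b i by blast
        then have "q i \<in> h" using halfspace_in h q i by blast
        moreover have "a i \<notin> h" using halfspace_out[of h y "s i" "a i"] h a X si i False by blast
        ultimately show ?thesis using i by (intro bexI[of _ "(i, True)"]) auto
      qed
    qed (use X a b q \<open>finite J\<close> in auto)
    then show ?thesis by (simp add: case_prod_beta)
  qed
  also have "\<dots> = (\<Sum>i\<in>J. d (q i) (a i) + d (q i) (b i))"
    by (simp add: sum.cartesian_product[symmetric] UNIV_bool add.commute)
  also have "\<dots> \<le> (\<Sum>i\<in>J. d (s i) (t i))"
  proof (rule sum_mono)
    fix i assume i: "i \<in> J"
    have "d (q i) (a i) + d (q i) (b i) = d (a i) (b i)"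
      using q(2)[OF i] by (simp add: interval_iff commute)
    also have "\<dots> \<le> d (s i) (t i)"
      unfolding a_def b_def using med_lipschitz X st[OF i] by simp
    finally show "d (q i) (a i) + d (q i) (b i) \<le> d (s i) (t i)" .
  qed
  finally show ?thesis .
qed


section \<open>Countable covers by compactness\<close>

abbreviation W :: "'a \<Rightarrow> 'a \<Rightarrow> 'a set set set" where
  "W \<equiv> walls_between X (convex_walls X d)"

abbreviation \<mu> :: "'a set set set \<Rightarrow> ennreal" where
  "\<mu> \<equiv> wall_outer_measure X d"

lemma convex_walls_eq: "convex_walls X d = wall_of X ` {h. halfspace h}"
  by (simp add: convex_walls_def halfspace_def)

lemma W_wall_of_iff:
  assumes "halfspace h" "x \<in> X" "y \<in> X"
  shows "wall_of X h \<in> W x y \<longleftrightarrow> (x \<in> h) \<noteq> (y \<in> h)"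
  using separates_wall_of[OF halfspace_subset[OF assms(1)] assms(2,3)] assms(1)
  by (auto simp: walls_between_def convex_walls_eq)

lemma W_cases:
  assumes "w \<in> W x y" "x \<in> X" "y \<in> X"
  obtains h where "halfspace h" "w = wall_of X h" "x \<in> h" "y \<notin> h"
proof -
  obtain k where k: "halfspace k" "w = wall_of X k" 
    using assms by (auto simp: walls_between_def convex_walls_eq)
  then have *: "(x \<in> k) \<noteq> (y \<in> k)" using W_wall_of_iff assms by blast
  show thesis
  proof (cases "x \<in> k")
    case True
    then show thesis using that k * by blast
  next
    case False
    have "w = wall_of X (X - k)" using k halfspace_subset[of k] by (auto simp: wall_of_def)
    then show thesis using that[of "X - k"] halfspace_compl k(1) * False assms by blast
  qed
qed

lemma W_subset: "W x y \<subseteq> convex_walls X d"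
  by (auto simp: walls_between_def)

text \<open>Tychonoff's theorem for the cube \<open>'a \<Rightarrow> bool\<close>, whose points are the predicates on \<open>'a\<close>.\<close>

lemma finite_subcover:
  fixes s t :: "nat \<Rightarrow> 'a"
  assumes X: "x \<in> X" "y \<in> X" and st: "range s \<subseteq> X" "range t \<subseteq> X"
    and cov: "W x y \<subseteq> (\<Union>n. W (s n) (t n))"
  shows "\<exists>N. \<forall>h. halfspace h \<longrightarrow> x \<in> h \<longrightarrow> y \<notin> h \<longrightarrow> (\<exists>n<N. (s n \<in> h) \<noteq> (t n \<in> h))"
proof -
  define T where "T = product_topology (\<lambda>_. discrete_topology (UNIV :: bool set)) (UNIV :: 'a set)"
  have top: "topspace T = UNIV" by (simp add: T_def)
  have comp: "compact_space T"
    unfolding T_def compact_space_product_topology by (simp add: compact_space_discrete_topology)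
  have coord: "openin T {f. f a = v}" for a v
  proof -
    have "continuous_map T (discrete_topology UNIV) (\<lambda>f. f a)"
      unfolding T_def by (rule continuous_map_product_projection) simp
    from openin_continuous_map_preimage[OF this, of "{v}"] show ?thesis by (simp add: top)
  qed
  have pos: "openin T {f. f a}" and neg: "openin T {f. \<not> f a}" for a
    using coord[of a True] coord[of a False] by simp_all
  \<comment> \<open>\<open>K\<close> is the set to be covered, by the clopen sets \<open>V n\<close>; the open sets in \<open>A\<close> cover its
    complement, that is, \<open>K\<close> is closed.\<close>
  define K where "K = {f. halfspace (Collect f) \<and> f x \<and> \<not> f y}"
  define V where "V n = {f :: 'a \<Rightarrow> bool. f (s n) \<noteq> f (t n)}" for n
  define A where "A = {U. openin T U \<and> U \<inter> K = {}}"
  have V: "openin T (V n)" for n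
  proof -
    have "V n = ({f. f (s n)} \<inter> {f. \<not> f (t n)}) \<union> ({f. \<not> f (s n)} \<inter> {f. f (t n)})"
      by (auto simp: V_def)
    then show ?thesis using pos neg by (metis openin_Int openin_Un)
  qed
  have A: "f \<in> \<Union>A" if f: "f \<notin> K" for f
  proof -
    define h where "h = Collect f"
    consider "\<not> f x" | "f y" | z where "z \<notin> X" "f z"
      | a b c where "f a" "f b" "c \<in> I a b" "\<not> f c"
      | a b c where "a \<in> X" "b \<in> X" "\<not> f a" "\<not> f b" "c \<in> I a b" "f c"
    proof -
      have "\<not> halfspace h \<or> \<not> f x \<or> f y" using f by (auto simp: K_def h_def)
      then show thesis
        using that interval_in_space unfolding halfspace_def median_convex_def h_def by blast
    qed
    then show ?thesis
    proof cases
      case 1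
      then have "f \<in> {f. \<not> f x}" "{f. \<not> f x} \<in> A" using neg by (auto simp: A_def K_def)
      then show ?thesis by blast
    next
      case 2
      then have "f \<in> {f. f y}" "{f. f y} \<in> A" using pos by (auto simp: A_def K_def)
      then show ?thesis by blast
    next
      case 3
      then have "f \<in> {f. f z}" "{f. f z} \<in> A"
        using pos halfspace_subset by (auto simp: A_def K_def)
      then show ?thesis by blast
    next
      case 4
      have "openin T ({f. f a} \<inter> {f. f b} \<inter> {f. \<not> f c})"
        using pos neg by (intro openin_Int)
      moreover have "({f. f a} \<inter> {f. f b} \<inter> {f. \<not> f c}) \<inter> K = {}"
        using halfspace_in[of _ a b c] 4(3) by (auto simp: K_def)
      ultimately have "({f. f a} \<inter> {f. f b} \<inter> {f. \<not> f c}) \<in> A" by (simp add: A_def)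
      then show ?thesis using 4 by blast
    next
      case 5
      have "openin T ({f. \<not> f a} \<inter> {f. \<not> f b} \<inter> {f. f c})"
        using pos neg by (intro openin_Int)
      moreover have "({f. \<not> f a} \<inter> {f. \<not> f b} \<inter> {f. f c}) \<inter> K = {}"
        using halfspace_out[of _ a b c] 5(1,2,5) by (auto simp: K_def)
      ultimately have "({f. \<not> f a} \<inter> {f. \<not> f b} \<inter> {f. f c}) \<in> A" by (simp add: A_def)
      then show ?thesis using 5 by blast
    qed
  qed
  have KV: "f \<in> (\<Union>n. V n)" if "f \<in> K" for f
  proof -
    have h: "halfspace (Collect f)" "x \<in> Collect f" "y \<notin> Collect f" using that by (auto simp: K_def)
    then have "wall_of X (Collect f) \<in> W x y" using W_wall_of_iff X by blast
    then obtain n where "wall_of X (Collect f) \<in> W (s n) (t n)" using cov by blast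
    then have "f (s n) \<noteq> f (t n)"
      using W_wall_of_iff[OF h(1), of "s n" "t n"] st by (auto simp: subset_iff)
    then show ?thesis by (auto simp: V_def)
  qed
  have "UNIV \<subseteq> \<Union>(A \<union> range V)" using A KV by blast
  moreover have "openin T U" if "U \<in> A \<union> range V" for U using that V by (auto simp: A_def)
  ultimately obtain F where F: "finite F" "F \<subseteq> A \<union> range V" "UNIV \<subseteq> \<Union>F"
    using comp unfolding compact_space_def compactin_def top by meson
  have "finite (F \<inter> range V)" "F \<inter> range V \<subseteq> range V" using F(1) by auto
  then obtain S where S: "finite S" "F \<inter> range V = V ` S"
    using finite_subset_image[of "F \<inter> range V" V UNIV] by auto
  have "\<exists>n<Suc (Max S). (s n \<in> h) \<noteq> (t n \<in> h)" if h: "halfspace h" "x \<in> h" "y \<notin> h" for h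
  proof -
    have K: "(\<lambda>z. z \<in> h) \<in> K" using h by (simp add: K_def)
    obtain U where U: "U \<in> F" "(\<lambda>z. z \<in> h) \<in> U" using F(3) by blast
    then have "U \<notin> A" using K by (auto simp: A_def)
    then have "U \<in> V ` S" using U F(2) S(2) by blast
    then obtain n where "n \<in> S" "(\<lambda>z. z \<in> h) \<in> V n" using U by blast
    then show ?thesis using S(1) by (intro exI[of _ n]) (auto simp: V_def le_imp_less_Suc)
  qed
  then show ?thesis by blast
qed

lemma dist_le_suminf:
  fixes s t :: "nat \<Rightarrow> 'a"
  assumes X: "x \<in> X" "y \<in> X" and st: "range s \<subseteq> X" "range t \<subseteq> X"
    and cov: "W x y \<subseteq> (\<Union>n. W (s n) (t n))"
  shows "ennreal (d x y) \<le> (\<Sum>n. ennreal (d (s n) (t n)))"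
proof -
  obtain N where N: "\<And>h. halfspace h \<Longrightarrow> x \<in> h \<Longrightarrow> y \<notin> h \<Longrightarrow> \<exists>n<N. (s n \<in> h) \<noteq> (t n \<in> h)"
    using finite_subcover[OF assms] by blast
  have "d x y \<le> (\<Sum>n<N. d (s n) (t n))"
    using dist_le_sum_finite[of "{..<N}" x y s t] X st N by (auto simp: subset_iff Bex_def)
  then have "ennreal (d x y) \<le> ennreal (\<Sum>n<N. d (s n) (t n))" by (rule ennreal_leI)
  also have "\<dots> = (\<Sum>n<N. ennreal (d (s n) (t n)))" by (simp add: sum_ennreal)
  also have "\<dots> \<le> (\<Sum>n. ennreal (d (s n) (t n)))"
    by (rule sum_le_suminf) (auto intro: summableI)
  finally show ?thesis .
qed

section \<open>The measure on convex walls\<close>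

lemma outer_le:
  assumes "range s \<subseteq> X" "range t \<subseteq> X" "Q \<subseteq> (\<Union>n. W (s n) (t n))"
  shows "\<mu> Q \<le> (\<Sum>n. ennreal (d (s n) (t n)))"
  unfolding wall_outer_measure_def using assms by (intro Inf_lower) blast

lemma outer_mono:
  assumes "Q \<subseteq> R"
  shows "\<mu> Q \<le> \<mu> R"
  unfolding wall_outer_measure_def
proof (rule Inf_superset_mono, clarify)
  fix x y :: "nat \<Rightarrow> 'a"
  assume "range x \<subseteq> X" "range y \<subseteq> X" "R \<subseteq> (\<Union>n. W (x n) (y n))"
  moreover from assms this(3) have "Q \<subseteq> (\<Union>n. W (x n) (y n))" by (rule order_trans)
  ultimately show "\<exists>s t. (\<Sum>n. ennreal (d (x n) (y n))) = (\<Sum>n. ennreal (d (s n) (t n))) \<and>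
      range s \<subseteq> X \<and> range t \<subseteq> X \<and> Q \<subseteq> (\<Union>n. W (s n) (t n))"
    by (intro exI[of _ x] exI[of _ y] conjI refl)
qed

lemma outer_between:
  assumes "x \<in> X" "y \<in> X"
  shows "\<mu> (W x y) = ennreal (d x y)"
proof (rule antisym)
  have "\<mu> (W x y) \<le> (\<Sum>n::nat. ennreal (d x (if n = 0 then y else x)))"
    using assms by (intro outer_le) (auto split: if_splits)
  also have "(\<lambda>n::nat. ennreal (d x (if n = 0 then y else x)))
      = (\<lambda>n. if n = 0 then ennreal (d x y) else 0)"
    using assms by (auto simp: fun_eq_iff)
  also have "(\<Sum>n::nat. if n = 0 then ennreal (d x y) else 0) = ennreal (d x y)"
    by (rule sums_unique[OF sums_single[of 0 "\<lambda>_. ennreal (d x y)"], symmetric])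
  finally show "\<mu> (W x y) \<le> ennreal (d x y)" .
  show "ennreal (d x y) \<le> \<mu> (W x y)"
    unfolding wall_outer_measure_def using dist_le_suminf[OF assms] by (intro Inf_greatest) blast
qed

lemma outer_empty:
  assumes "X \<noteq> {}"
  shows "\<mu> {} = 0"
proof -
  obtain x where x: "x \<in> X" using assms by blast
  have "\<mu> {} \<le> \<mu> (W x x)" by (rule outer_mono) simp
  then show ?thesis using outer_between[OF x x] x by simp
qed

lemma outer_close:
  assumes "\<mu> Q < c"
  shows "\<exists>s t :: nat \<Rightarrow> 'a. range s \<subseteq> X \<and> range t \<subseteq> X \<and> Q \<subseteq> (\<Union>n. W (s n) (t n)) \<and>
    (\<Sum>n. ennreal (d (s n) (t n))) < c"
  using assms unfolding wall_outer_measure_def Inf_less_iff by auto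

text \<open>Countable subadditivity, by the usual \<open>e / 2 ^ n\<close> argument.\<close>

lemma outer_UN_le: "\<mu> (\<Union>n::nat. Q n) \<le> (\<Sum>n. \<mu> (Q n))"
proof (rule ennreal_le_epsilon)
  fix e :: real assume e: "0 < e" and fin: "(\<Sum>n. \<mu> (Q n)) < top"
  define C where "C n s t \<longleftrightarrow> range s \<subseteq> X \<and> range t \<subseteq> X \<and>
      Q n \<subseteq> (\<Union>i. W (s i) (t i)) \<and>
      (\<Sum>i. ennreal (d (s i) (t i))) < \<mu> (Q n) + e * (1/2) ^ Suc n"
    for n and s t :: "nat \<Rightarrow> 'a"
  have "\<mu> (Q n) < \<mu> (Q n) + e * (1/2) ^ Suc n" for n
    using e fin by (auto simp add: less_top dest!: ennreal_suminf_lessD)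
  then have "\<exists>s t. C n s t" for n
    unfolding C_def by (rule outer_close)
  then obtain s t where C: "\<And>n. C n (s n) (t n)" by metis
  have st: "range (s n) \<subseteq> X" "range (t n) \<subseteq> X" "Q n \<subseteq> (\<Union>i. W (s n i) (t n i))"
    and le: "(\<Sum>i. ennreal (d (s n i) (t n i))) < \<mu> (Q n) + e * (1/2) ^ Suc n" for n
    using C[of n] unfolding C_def by blast+
  let ?s = "\<lambda>k. s (fst (prod_decode k)) (snd (prod_decode k))"
    and ?t = "\<lambda>k. t (fst (prod_decode k)) (snd (prod_decode k))"
  have "(\<Union>n. Q n) \<subseteq> (\<Union>k. W (?s k) (?t k))"
  proof
    fix w assume "w \<in> (\<Union>n. Q n)"
    then obtain n i where "w \<in> W (s n i) (t n i)" using st(3) by blast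
    then have "w \<in> W (?s (prod_encode (n, i))) (?t (prod_encode (n, i)))" by simp
    then show "w \<in> (\<Union>k. W (?s k) (?t k))" by blast
  qed
  then have "\<mu> (\<Union>n. Q n) \<le> (\<Sum>k. ennreal (d (?s k) (?t k)))"
  proof (intro outer_le)
    show "range ?s \<subseteq> X" "range ?t \<subseteq> X" by (simp_all add: image_subset_iff range_subsetD[OF st(1)] range_subsetD[OF st(2)])
  qed
  also have "\<dots> = (\<Sum>n. \<Sum>i. ennreal (d (s n i) (t n i)))"
    by (rule suminf_ennreal_2dimen[where f =
          "\<lambda>p. ennreal (d (s (fst p) (snd p)) (t (fst p) (snd p)))"])
      (simp only: fst_conv snd_conv)
  also have "\<dots> \<le> (\<Sum>n. \<mu> (Q n) + e * (1/2) ^ Suc n)"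
    using le by (intro suminf_le) (auto intro: less_imp_le)
  also have "\<dots> = (\<Sum>n. \<mu> (Q n)) + (\<Sum>n. ennreal e * ennreal ((1/2) ^ Suc n))"
    using e by (subst suminf_add[symmetric])
      (auto simp del: ennreal_suminf_cmult simp add: ennreal_mult[symmetric])
  also have "\<dots> = (\<Sum>n. \<mu> (Q n)) + e"
    unfolding ennreal_suminf_cmult
    by (subst suminf_ennreal_eq[OF zero_le_power power_half_series]) simp_all
  finally show "\<mu> (\<Union>n. Q n) \<le> (\<Sum>n. \<mu> (Q n)) + e" .
qed

lemma outer_Un_le:
  assumes "X \<noteq> {}"
  shows "\<mu> (Q \<union> R) \<le> \<mu> Q + \<mu> R"
  using outer_UN_le[of "binaryset Q R"]
  by (simp add: UN_binaryset_eq suminf_binaryset_eq[where f = \<mu>, OF outer_empty[OF assms]])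

text \<open>With \<open>u\<close> and \<open>v\<close> the projections of \<open>a\<close> and \<open>b\<close> to the interval from \<open>x\<close> to \<open>y\<close>, the points
  \<open>u, q, v, r\<close> are the corners of a rectangle whose corners nearest to \<open>x\<close> and \<open>y\<close> are \<open>q\<close> and
  \<open>r\<close>. Opposite sides of it have equal lengths, so the four pieces have total length \<open>d x y\<close>.\<close>

lemma walls_between_split:
  assumes X: "x \<in> X" "y \<in> X" and ab: "a \<in> X" "b \<in> X"
  obtains u v q r where "u \<in> X" "v \<in> X" "q \<in> X" "r \<in> X"
    "W x y \<inter> W a b \<subseteq> W q u \<union> W q v" "W x y - W a b \<subseteq> W x q \<union> W r y"
    "(d q u + d q v) + (d x q + d r y) = d x y"
proof
  define u where "u = med x y a"
  define v where "v = med x y b"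
  define q where "q = med u v x"
  define r where "r = med u v y"
  have u: "u \<in> X" "u \<in> I x y" "u \<in> I y a" "u \<in> I x a"
    unfolding u_def using X ab by (simp_all add: med_in_space med_in1 med_in2 med_in3)
  have v: "v \<in> X" "v \<in> I x y" "v \<in> I y b" "v \<in> I x b"
    unfolding v_def using X ab by (simp_all add: med_in_space med_in1 med_in2 med_in3)
  have q: "q \<in> X" "q \<in> I u v" "q \<in> I v x" "q \<in> I u x"
    unfolding q_def using X u v by (simp_all add: med_in_space med_in1 med_in2 med_in3)
  have r: "r \<in> X" "r \<in> I u v" "r \<in> I v y" "r \<in> I u y"
    unfolding r_def using X u v by (simp_all add: med_in_space med_in1 med_in2 med_in3)
  show "u \<in> X" "v \<in> X" "q \<in> X" "r \<in> X" by fact+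
  \<comment> \<open>Over half-spaces with \<open>x\<close> inside and \<open>y\<close> outside, \<open>u\<close> behaves like \<open>a\<close> and \<open>v\<close> like
    \<open>b\<close>.\<close>
  have split: "(((q \<in> h) \<noteq> (u \<in> h) \<or> (q \<in> h) \<noteq> (v \<in> h)) \<and> (a \<in> h) \<noteq> (b \<in> h)) \<or>
      (((x \<in> h) \<noteq> (q \<in> h) \<or> (r \<in> h) \<noteq> (y \<in> h)) \<and> (a \<in> h) = (b \<in> h))"
    if h: "halfspace h" "x \<in> h" "y \<notin> h" for h
  proof -
    have "u \<in> h \<longleftrightarrow> a \<in> h"
      using halfspace_in[OF h(1,2) _ u(4)] halfspace_out[OF h(1) X(2) ab(1) h(3) _ u(3)] by blast
    moreover have "v \<in> h \<longleftrightarrow> b \<in> h"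
      using halfspace_in[OF h(1,2) _ v(4)] halfspace_out[OF h(1) X(2) ab(2) h(3) _ v(3)] by blast
    moreover have "q \<notin> h" if "u \<notin> h" "v \<notin> h"
      using halfspace_out[OF h(1) u(1) v(1) that q(2)] .
    moreover have "r \<in> h" if "u \<in> h" "v \<in> h"
      using halfspace_in[OF h(1) that r(2)] .
    ultimately show ?thesis using h(2,3) by metis
  qed
  show "W x y \<inter> W a b \<subseteq> W q u \<union> W q v"
  proof
    fix w assume w: "w \<in> W x y \<inter> W a b"
    then obtain h where h: "halfspace h" "w = wall_of X h" "x \<in> h" "y \<notin> h"
      using W_cases X by blast
    then show "w \<in> W q u \<union> W q v"
      using split[OF h(1,3,4)] w W_wall_of_iff[OF h(1)] ab u(1) v(1) q(1) by auto
  qed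
  show "W x y - W a b \<subseteq> W x q \<union> W r y"
  proof
    fix w assume w: "w \<in> W x y - W a b"
    then obtain h where h: "halfspace h" "w = wall_of X h" "x \<in> h" "y \<notin> h"
      using W_cases X by blast
    then show "w \<in> W x q \<union> W r y"
      using split[OF h(1,3,4)] w W_wall_of_iff[OF h(1)] ab X q(1) r(1) by auto
  qed
  show "(d q u + d q v) + (d x q + d r y) = d x y"
    using u(2) v(2) q(2-4) r(2-4) unfolding interval_iff
    using commute[of u q] commute[of v q] commute[of q x] commute[of u x] commute[of v x] commute[of v r]
    by linarith
qed

lemma between_lambda_system:
  assumes ne: "X \<noteq> {}" and ab: "a \<in> X" "b \<in> X"
  shows "W a b \<in> lambda_system (convex_walls X d) (Pow (convex_walls X d)) \<mu>"
proof -
  interpret algebra "convex_walls X d" "Pow (convex_walls X d)" by (rule algebra_Pow)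
  have "\<mu> (Q \<inter> W a b) + \<mu> (Q - W a b) = \<mu> Q" for Q
  proof (rule antisym)
    have piece: "\<mu> (W x y \<inter> W a b) + \<mu> (W x y - W a b) \<le> ennreal (d x y)"
      if X: "x \<in> X" "y \<in> X" for x y
    proof -
      obtain u v q r where p: "u \<in> X" "v \<in> X" "q \<in> X" "r \<in> X"
        "W x y \<inter> W a b \<subseteq> W q u \<union> W q v" "W x y - W a b \<subseteq> W x q \<union> W r y"
        "(d q u + d q v) + (d x q + d r y) = d x y"
        using walls_between_split[OF X ab] .
      have "\<mu> (W x y \<inter> W a b) \<le> \<mu> (W q u) + \<mu> (W q v)"
        using outer_mono[OF p(5)] outer_Un_le[OF ne] by (rule order_trans)
      moreover have "\<mu> (W x y - W a b) \<le> \<mu> (W x q) + \<mu> (W r y)"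
        using outer_mono[OF p(6)] outer_Un_le[OF ne] by (rule order_trans)
      ultimately have "\<mu> (W x y \<inter> W a b) + \<mu> (W x y - W a b)
          \<le> (\<mu> (W q u) + \<mu> (W q v)) + (\<mu> (W x q) + \<mu> (W r y))" by (rule add_mono)
      also have "\<dots> = ennreal (d x y)"
        using p X by (simp add: outer_between ennreal_plus[symmetric] del: ennreal_plus)
      finally show ?thesis .
    qed
    show "\<mu> (Q \<inter> W a b) + \<mu> (Q - W a b) \<le> \<mu> Q"
      unfolding wall_outer_measure_def[of X d Q]
    proof (rule Inf_greatest, clarify)
      fix s t :: "nat \<Rightarrow> 'a"
      assume st: "range s \<subseteq> X" "range t \<subseteq> X" and Q: "Q \<subseteq> (\<Union>n. W (s n) (t n))"
      have "\<mu> (Q \<inter> W a b) \<le> \<mu> (\<Union>n. W (s n) (t n) \<inter> W a b)"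
        using Q by (intro outer_mono) blast
      also have "\<dots> \<le> (\<Sum>n. \<mu> (W (s n) (t n) \<inter> W a b))" by (rule outer_UN_le)
      finally have 1: "\<mu> (Q \<inter> W a b) \<le> (\<Sum>n. \<mu> (W (s n) (t n) \<inter> W a b))" .
      have "\<mu> (Q - W a b) \<le> \<mu> (\<Union>n. W (s n) (t n) - W a b)"
        using Q by (intro outer_mono) blast
      also have "\<dots> \<le> (\<Sum>n. \<mu> (W (s n) (t n) - W a b))" by (rule outer_UN_le)
      finally have 2: "\<mu> (Q - W a b) \<le> (\<Sum>n. \<mu> (W (s n) (t n) - W a b))" .
      have "\<mu> (Q \<inter> W a b) + \<mu> (Q - W a b) \<le>
          (\<Sum>n. \<mu> (W (s n) (t n) \<inter> W a b) + \<mu> (W (s n) (t n) - W a b))"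
        using add_mono[OF 1 2] by (simp add: suminf_add)
      also have "\<dots> \<le> (\<Sum>n. ennreal (d (s n) (t n)))"
        using piece st by (intro suminf_le) (auto intro: summableI simp: subset_iff)
      finally show "\<mu> (Q \<inter> W a b) + \<mu> (Q - W a b) \<le> (\<Sum>n. ennreal (d (s n) (t n)))" .
    qed
    show "\<mu> Q \<le> \<mu> (Q \<inter> W a b) + \<mu> (Q - W a b)"
      using outer_Un_le[OF ne, of "Q \<inter> W a b" "Q - W a b"] by (simp add: Int_Diff_Un)
  qed
  then show ?thesis using W_subset by (simp add: lambda_system_eq)
qed

text \<open>For \<open>X = {}\<close> this fails: there the outer measure of the empty set is \<open>\<infinity>\<close>.\<close>

lemma canonical_measure_space:
  assumes ne: "X \<noteq> {}"
  shows "measure_space (convex_walls X d)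
    (sigma_sets (convex_walls X d) {W x y | x y. x \<in> X \<and> y \<in> X}) \<mu>"
proof -
  interpret sigma_algebra "convex_walls X d" "Pow (convex_walls X d)" by (rule sigma_algebra_Pow)
  have oms: "outer_measure_space (Pow (convex_walls X d)) \<mu>"
    by (auto simp: outer_measure_space_def positive_def increasing_def countably_subadditive_def
        outer_empty[OF ne] intro: outer_mono outer_UN_le)
  have ms: "measure_space (convex_walls X d)
      (lambda_system (convex_walls X d) (Pow (convex_walls X d)) \<mu>) \<mu>"
    by (rule caratheodory_lemma[OF oms])
  then interpret L: sigma_algebra "convex_walls X d"
      "lambda_system (convex_walls X d) (Pow (convex_walls X d)) \<mu>"
    by (simp add: measure_space_def)
  show ?thesis
  proof (rule measure_down[OF ms])
    show "sigma_algebra (convex_walls X d)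
        (sigma_sets (convex_walls X d) {W x y | x y. x \<in> X \<and> y \<in> X})"
      using W_subset by (intro sigma_algebra_sigma_sets) blast
    show "sigma_sets (convex_walls X d) {W x y | x y. x \<in> X \<and> y \<in> X}
        \<subseteq> lambda_system (convex_walls X d) (Pow (convex_walls X d)) \<mu>"
      using between_lambda_system[OF ne] by (intro L.sigma_sets_subset) blast
  qed
qed

lemma space_canonical: "space (canonical_walls X d) = convex_walls X d"
  unfolding canonical_walls_def using W_subset by (intro space_measure_of) blast

lemma sets_canonical: "sets (canonical_walls X d) =
    sigma_sets (convex_walls X d) {W x y | x y. x \<in> X \<and> y \<in> X}"
  unfolding canonical_walls_def using W_subset by (intro sets_measure_of) blast

lemma emeasure_canonical:
  assumes "X \<noteq> {}" "Q \<in> sets (canonical_walls X d)"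
  shows "emeasure (canonical_walls X d) Q = \<mu> Q"
  using canonical_measure_space[OF assms(1)] assms(2)
  unfolding sets_canonical by (simp add: canonical_walls_def emeasure_measure_of_conv)

lemma between_in_sets:
  assumes "x \<in> X" "y \<in> X"
  shows "W x y \<in> sets (canonical_walls X d)"
  unfolding sets_canonical using assms by (intro sigma_sets.Basic) blast

lemma emeasure_between:
  assumes "x \<in> X" "y \<in> X"
  shows "emeasure (canonical_walls X d) (W x y) = ennreal (d x y)"
  using emeasure_canonical[OF _ between_in_sets[OF assms]] outer_between[OF assms] assms by auto

lemma measured_walls_canonical: "measured_walls X (canonical_walls X d)"
  unfolding measured_walls_def
proof (intro conjI ballI)
  show "\<exists>H. halfspace_collection X H \<and> space (canonical_walls X d) = wall_of X ` H"
    using halfspace_subset halfspace_compl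
    by (intro exI[of _ "{h. halfspace h}"])
       (auto simp: halfspace_collection_def space_canonical convex_walls_eq)
qed (auto simp: space_canonical between_in_sets emeasure_between)

lemma wall_pdist_canonical:
  assumes "x \<in> X" "y \<in> X"
  shows "wall_pdist X (canonical_walls X d) x y = d x y"
  using emeasure_between[OF assms] by (simp add: wall_pdist_def space_canonical measure_def)

end

lemma median_metric_iff: "median_metric X d \<longleftrightarrow> median_space X d"
  by (auto simp: median_metric_def median_metric_axioms_def median_space_def)

section \<open>Isometries and canonical walls\<close>

lemma halfspace_pullback:
  assumes "median_metric X d" "median_metric X' d'" and iso: "isometric_embedding X d X' d' \<phi>"
    and h: "median_metric.halfspace X' d' h"
  shows "median_metric.halfspace X d (\<phi> -` h \<inter> X)"
proof -
  interpret A: median_metric X d by fact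
  interpret B: median_metric X' d' by fact
  have \<phi>: "\<phi> x \<in> X'" "d' (\<phi> x) (\<phi> y) = d x y" if "x \<in> X" "y \<in> X" for x y
    using iso that by (auto simp: isometric_embedding_def)
  have between: "\<phi> c \<in> B.I (\<phi> a) (\<phi> b)" if "a \<in> X" "b \<in> X" "c \<in> A.I a b" for a b c
    using that \<phi> by (auto simp: A.interval_iff B.interval_iff)
  show ?thesis
    unfolding A.halfspace_def median_convex_def
  proof (intro conjI ballI subsetI)
    fix a b c assume "a \<in> \<phi> -` h \<inter> X" "b \<in> \<phi> -` h \<inter> X" "c \<in> A.I a b"
    then show "c \<in> \<phi> -` h \<inter> X"
      using between[of a b c] B.halfspace_in[OF h] A.interval_in_space by auto
  next
    fix a b c assume "a \<in> X - (\<phi> -` h \<inter> X)" "b \<in> X - (\<phi> -` h \<inter> X)" "c \<in> A.I a b"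
    then show "c \<in> X - (\<phi> -` h \<inter> X)"
      using between[of a b c] B.halfspace_out[OF h, of "\<phi> a" "\<phi> b" "\<phi> c"] \<phi>(1) A.interval_in_space
      by auto
  qed auto
qed

lemma wall_pullback_convex_walls:
  assumes "median_metric X d" "median_metric X' d'" and iso: "isometric_embedding X d X' d' \<phi>"
    and w: "w \<in> convex_walls X' d'"
  shows "wall_pullback X \<phi> w \<in> convex_walls X d"
proof -
  interpret A: median_metric X d by fact
  interpret B: median_metric X' d' by fact
  obtain h where h: "B.halfspace h" "w = wall_of X' h"
    using w by (auto simp: B.convex_walls_eq)
  have "wall_pullback X \<phi> w = wall_of X (\<phi> -` h \<inter> X)"
    using pullback_wall_of[of \<phi> X X', OF _ B.halfspace_subset[OF h(1)]] iso h(2)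
    by (simp add: isometric_embedding_def)
  then show ?thesis using halfspace_pullback[OF assms(1-3) h(1)] by (simp add: A.convex_walls_eq)
qed

lemma wall_pullback_between:
  assumes "median_metric X d" "median_metric X' d'" and iso: "isometric_embedding X d X' d' \<phi>"
    and xy: "x \<in> X" "y \<in> X"
  shows "wall_pullback X \<phi> -` walls_between X (convex_walls X d) x y \<inter> convex_walls X' d' =
    walls_between X' (convex_walls X' d') (\<phi> x) (\<phi> y)"
proof -
  interpret A: median_metric X d by fact
  interpret B: median_metric X' d' by fact
  have \<phi>: "\<phi> \<in> X \<rightarrow> X'" "\<phi> x \<in> X'" "\<phi> y \<in> X'"
    using iso xy by (auto simp: isometric_embedding_def)
  have "wall_pullback X \<phi> w \<in> A.W x y \<longleftrightarrow> w \<in> B.W (\<phi> x) (\<phi> y)"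
    if w: "w \<in> convex_walls X' d'" for w
  proof -
    obtain h where h: "B.halfspace h" "w = wall_of X' h"
      using w by (auto simp: B.convex_walls_eq)
    have "wall_pullback X \<phi> w = wall_of X (\<phi> -` h \<inter> X)"
      using pullback_wall_of[OF \<phi>(1) B.halfspace_subset[OF h(1)]] h(2) by simp
    then show ?thesis
      using A.W_wall_of_iff[OF halfspace_pullback[OF assms(1-3) h(1)] xy]
        B.W_wall_of_iff[OF h(1) \<phi>(2,3)] xy h(2) by simp
  qed
  then show ?thesis using B.W_subset by blast
qed

lemma outer_pullback_le:
  assumes "median_metric X d" "median_metric X' d'" and iso: "isometric_embedding X d X' d' \<phi>"
  shows "wall_outer_measure X' d' (wall_pullback X \<phi> -` Q \<inter> convex_walls X' d')
    \<le> wall_outer_measure X d Q"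
proof -
  interpret A: median_metric X d by fact
  interpret B: median_metric X' d' by fact
  let ?p = "wall_pullback X \<phi>"
  show ?thesis
    unfolding wall_outer_measure_def[of X d Q]
  proof (rule Inf_greatest, clarify)
    fix s t :: "nat \<Rightarrow> 'a"
    assume st: "range s \<subseteq> X" "range t \<subseteq> X" and Q: "Q \<subseteq> (\<Union>n. A.W (s n) (t n))"
    have X: "s n \<in> X" "t n \<in> X" for n using st by auto
    have \<phi>: "\<phi> x \<in> X'" "d' (\<phi> x) (\<phi> y) = d x y" if "x \<in> X" "y \<in> X" for x y
      using iso that by (auto simp: isometric_embedding_def)
    have "?p -` Q \<inter> convex_walls X' d' \<subseteq> (\<Union>n. ?p -` A.W (s n) (t n) \<inter> convex_walls X' d')"
      using Q by blast
    also have "\<dots> = (\<Union>n. B.W (\<phi> (s n)) (\<phi> (t n)))"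
      using wall_pullback_between[OF assms X] by simp
    finally have "wall_outer_measure X' d' (?p -` Q \<inter> convex_walls X' d')
        \<le> (\<Sum>n. ennreal (d' (\<phi> (s n)) (\<phi> (t n))))"
      using \<phi>(1)[OF X] \<phi>(1)[OF X(2) X(1)] by (intro B.outer_le) auto
    then show "wall_outer_measure X' d' (?p -` Q \<inter> convex_walls X' d')
        \<le> (\<Sum>n. ennreal (d (s n) (t n)))"
      using \<phi>(2)[OF X] by simp
  qed
qed

text \<open>With no points the outer measure is constantly \<open>\<infinity>\<close>, hence not a measure, and
  \<open>measure_of\<close> yields the zero measure.\<close>

lemma emeasure_canonical_empty: "emeasure (canonical_walls {} d) Q = 0"
proof -
  have "wall_outer_measure {} d {} \<noteq> 0" by (simp add: wall_outer_measure_def)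
  then have "\<not> measure_space (convex_walls {} d) A (wall_outer_measure {} d)" for A
    by (auto simp: measure_space_def positive_def)
  then show ?thesis by (simp add: canonical_walls_def emeasure_measure_of_conv)
qed

lemma wall_pullback_inverse:
  assumes "\<phi> \<in> X \<rightarrow> X'" "\<And>x. x \<in> X \<Longrightarrow> \<psi> (\<phi> x) = x" "w \<subseteq> Pow X"
  shows "wall_pullback X \<phi> (wall_pullback X' \<psi> w) = w"
proof -
  have "\<phi> -` (\<psi> -` h \<inter> X') \<inter> X = h" if "h \<in> w" for h
  proof -
    have "h \<subseteq> X" using assms(3) that by blast
    then show ?thesis using assms(1,2) by (auto simp: Pi_iff subset_iff)
  qed
  then show ?thesis by (simp add: wall_pullback_def image_image)
qed

lemma wall_hom_canonical:
  assumes A: "median_metric X d" and B: "median_metric X' d'"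
    and \<phi>: "isometric_embedding X d X' d' \<phi>" and \<psi>: "isometric_embedding X' d' X d \<psi>"
    and inv: "\<And>x. x \<in> X \<Longrightarrow> \<psi> (\<phi> x) = x"
  shows "wall_hom X (canonical_walls X d) X' (canonical_walls X' d') \<phi>"
proof -
  interpret A: median_metric X d by fact
  interpret B: median_metric X' d' by fact
  let ?p = "wall_pullback X \<phi>" and ?q = "wall_pullback X' \<psi>"
  let ?N = "canonical_walls X d" and ?N' = "canonical_walls X' d'"
  have maps: "\<phi> \<in> X \<rightarrow> X'" "\<psi> \<in> X' \<rightarrow> X" using \<phi> \<psi> by (auto simp: isometric_embedding_def)
  note p = wall_pullback_convex_walls[OF A B \<phi>] and q = wall_pullback_convex_walls[OF B A \<psi>]
  have pq: "?p (?q w) = w" if "w \<in> convex_walls X d" for w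
  proof (rule wall_pullback_inverse[OF maps(1) inv])
    show "w \<subseteq> Pow X"
      using that A.halfspace_subset by (auto simp: A.convex_walls_eq wall_of_def)
  qed
  have measurable: "?p \<in> measurable ?N' ?N"
  proof (rule measurable_sigma_sets[OF A.sets_canonical])
    show "{A.W x y |x y. x \<in> X \<and> y \<in> X} \<subseteq> Pow (convex_walls X d)"
      using A.W_subset by blast
    show "?p \<in> space ?N' \<rightarrow> convex_walls X d" using p by (auto simp: B.space_canonical)
    fix B assume "B \<in> {A.W x y |x y. x \<in> X \<and> y \<in> X}"
    then obtain x y where xy: "B = A.W x y" "x \<in> X" "y \<in> X" by blast
    then have "\<phi> x \<in> X'" "\<phi> y \<in> X'" using maps(1) by auto
    then show "?p -` B \<inter> space ?N' \<in> sets ?N'"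
      using wall_pullback_between[OF A B \<phi> xy(2,3)] B.between_in_sets xy(1)
      by (simp add: B.space_canonical)
  qed
  have emeasure: "emeasure ?N' (?p -` Q \<inter> space ?N') = emeasure ?N Q" if Q: "Q \<in> sets ?N" for Q
  proof (cases "X = {}")
    case True
    then have "X' = {}" using maps(2) by auto
    then show ?thesis using True by (simp add: emeasure_canonical_empty)
  next
    case False
    then have "X' \<noteq> {}" using maps(1) by auto
    have sub: "Q \<subseteq> convex_walls X d" using sets.sets_into_space[OF Q] by (simp add: A.space_canonical)
    let ?Q = "?p -` Q \<inter> convex_walls X' d'"
    have "A.\<mu> Q = B.\<mu> ?Q"
    proof (rule antisym)
      have "Q \<subseteq> ?q -` ?Q \<inter> convex_walls X d"
      proof
        fix w assume w: "w \<in> Q"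
        then have W: "w \<in> convex_walls X d" using sub by blast
        then show "w \<in> ?q -` ?Q \<inter> convex_walls X d" using w q[OF W] pq[OF W] by simp
      qed
      then have "A.\<mu> Q \<le> A.\<mu> (?q -` ?Q \<inter> convex_walls X d)" by (rule A.outer_mono)
      also have "\<dots> \<le> B.\<mu> ?Q" by (rule outer_pullback_le[OF B A \<psi>])
      finally show "A.\<mu> Q \<le> B.\<mu> ?Q" .
      show "B.\<mu> ?Q \<le> A.\<mu> Q" by (rule outer_pullback_le[OF A B \<phi>])
    qed
    moreover have "?Q \<in> sets ?N'"
      using measurable_sets[OF measurable Q] by (simp add: B.space_canonical)
    ultimately show ?thesis
      using A.emeasure_canonical[OF False Q] B.emeasure_canonical[OF \<open>X' \<noteq> {}\<close>]
      by (simp add: B.space_canonical)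
  qed
  show ?thesis
    unfolding wall_hom_def
  proof (intro conjI ballI)
    show "?p ` space ?N' = space ?N"
    proof
      show "?p ` space ?N' \<subseteq> space ?N" using p by (auto simp: A.space_canonical B.space_canonical)
      show "space ?N \<subseteq> ?p ` space ?N'"
        using q pq by (force simp: A.space_canonical B.space_canonical)
    qed
  qed (use maps p measurable_sets[OF measurable] emeasure in
      \<open>auto simp: A.space_canonical B.space_canonical\<close>)
qed

lemma wall_iso_canonical:
  assumes A: "median_metric X d" and B: "median_metric X' d'"
    and \<phi>: "isometric_embedding X d X' d' \<phi>" and surj: "\<phi> ` X = X'"
  shows "wall_iso X (canonical_walls X d) X' (canonical_walls X' d') \<phi>"
proof -
  interpret A: median_metric X d by fact
  interpret B: median_metric X' d' by fact
  have dist: "d' (\<phi> x) (\<phi> y) = d x y" if "x \<in> X" "y \<in> X" for x y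
    using \<phi> that by (auto simp: isometric_embedding_def)
  have inj: "inj_on \<phi> X"
  proof (rule inj_onI)
    fix x y assume xy: "x \<in> X" "y \<in> X" "\<phi> x = \<phi> y"
    then have "d x y = d x x" using dist[of x y] dist[of x x] by simp
    then show "x = y" using xy by simp
  qed
  let ?\<psi> = "inv_into X \<phi>"
  have \<psi>: "?\<psi> y \<in> X" "\<phi> (?\<psi> y) = y" if "y \<in> X'" for y
    using that surj by (auto intro: inv_into_into f_inv_into_f)
  have iso: "isometric_embedding X' d' X d ?\<psi>"
    using \<psi> dist[symmetric] by (simp add: isometric_embedding_def)
  show ?thesis
    unfolding wall_iso_def
  proof (intro conjI)
    show "bij_betw \<phi> X X'" using inj surj by (simp add: bij_betw_def)
    show "wall_hom X (canonical_walls X d) X' (canonical_walls X' d') \<phi>"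
      using inj by (intro wall_hom_canonical[OF A B \<phi> iso]) simp
    show "wall_hom X' (canonical_walls X' d') X (canonical_walls X d) ?\<psi>"
      using \<psi>(2) by (intro wall_hom_canonical[OF B A iso \<phi>])
  qed
qed

section \<open>Embedding in \<open>L\<^sup>1\<close>\<close>

lemma (in median_metric) L1_embedding:
  "\<exists>f. isometric_embedding X d (L1_space (canonical_walls X d)) (L1_dist (canonical_walls X d)) f"
proof (cases "X = {}")
  case True
  then show ?thesis by (simp add: isometric_embedding_def)
next
  case False
  then obtain z where z: "z \<in> X" by blast
  let ?N = "canonical_walls X d"
  define g :: "'a \<Rightarrow> 'a set set \<Rightarrow> real" where "g x = indicator (W z x)" for x
  have int: "integrable ?N (indicator (W x y) :: _ \<Rightarrow> real)" if "x \<in> X" "y \<in> X" for x y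
    using between_in_sets[OF that] emeasure_between[OF that]
    by (intro integrable_real_indicator) simp_all
  then have g: "integrable ?N (g x)" if "x \<in> X" for x using z that by (simp add: g_def)
  have "L1_dist ?N (L1_rel ?N `` {g x}) (L1_rel ?N `` {g y}) = d x y" if xy: "x \<in> X" "y \<in> X" for x y
  proof -
    have "\<bar>g x w - g y w\<bar> = indicator (W x y) w" if w: "w \<in> space ?N" for w
    proof -
      obtain h where "halfspace h" "w = wall_of X h"
        using w by (auto simp: space_canonical convex_walls_eq)
      then show ?thesis using W_wall_of_iff[of h] z xy by (auto simp: g_def indicator_def)
    qed
    then have "(\<integral>w. \<bar>g x w - g y w\<bar> \<partial>?N) = (\<integral>w. indicator (W x y) w \<partial>?N)"
      by (rule Bochner_Integration.integral_cong[OF refl])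
    also have "\<dots> = measure ?N (W x y \<inter> space ?N)" by simp
    also have "W x y \<inter> space ?N = W x y" using W_subset by (auto simp: space_canonical)
    also have "measure ?N (W x y) = d x y" using emeasure_between[OF xy] by (simp add: measure_def)
    finally show ?thesis using L1_dist_class[OF g[OF xy(1)] g[OF xy(2)]] by simp
  qed
  moreover have "L1_rel ?N `` {g x} \<in> L1_space ?N" if "x \<in> X" for x
    using g[OF that] unfolding L1_space_def by (intro quotientI) simp
  ultimately show ?thesis
    by (intro exI[of _ "\<lambda>x. L1_rel ?N `` {g x}"]) (simp add: isometric_embedding_def)
qed

theorem theorem1p1:
  shows
    "(\<forall>(X :: 'a set) N. measured_walls X N \<longrightarrow>
        (\<forall>\<sigma>\<in>section_space X N. \<forall>\<tau>\<in>section_space X N.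
           sym_diff \<sigma> \<tau> \<in> sets (halfspace_measure X N) \<and>
           emeasure (halfspace_measure X N) (sym_diff \<sigma> \<tau>) < \<infinity>) \<and>
        median_pseudo_metric_space (section_space X N) (section_pdist X N) \<and>
        pseudo_metric_on X (wall_pdist X N) \<and>
        isometric_embedding X (wall_pdist X N)
          (section_space X N) (section_pdist X N) (point_section N)) \<and>
     (\<forall>(X :: 'a set) N (X' :: 'b set) N' \<phi>.
        measured_walls X N \<longrightarrow> measured_walls X' N' \<longrightarrow> wall_hom X N X' N' \<phi> \<longrightarrow>
        isometric_embedding (section_space X N) (section_pdist X N)
          (section_space X' N') (section_pdist X' N') (induced_section_map X N' \<phi>)) \<and>
     (\<forall>(X :: 'a set) d. median_space X d \<longrightarrow>
        measured_walls X (canonical_walls X d) \<and>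
        (X \<noteq> {} \<longrightarrow> (\<forall>Q\<in>sets (canonical_walls X d).
           emeasure (canonical_walls X d) Q = wall_outer_measure X d Q)) \<and>
        (\<forall>x\<in>X. \<forall>y\<in>X. wall_pdist X (canonical_walls X d) x y = d x y)) \<and>
     (\<forall>(X :: 'a set) d (X' :: 'b set) d' \<phi>.
        median_space X d \<longrightarrow> median_space X' d' \<longrightarrow>
        isometric_embedding X d X' d' \<phi> \<longrightarrow> \<phi> ` X = X' \<longrightarrow>
        wall_iso X (canonical_walls X d) X' (canonical_walls X' d') \<phi>) \<and>
     (\<forall>(X :: 'a set) d. median_space X d \<longrightarrow>
        (\<exists>(N :: 'a set set measure) f. isometric_embedding X d (L1_space N) (L1_dist N) f))"
proof (intro conjI allI impI ballI)
  fix X :: "'a set" and N assume mw: "measured_walls X N"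
  fix \<sigma> \<tau> assume st: "\<sigma> \<in> section_space X N" "\<tau> \<in> section_space X N"
  show "sym_diff \<sigma> \<tau> \<in> sets (halfspace_measure X N)"
    "emeasure (halfspace_measure X N) (sym_diff \<sigma> \<tau>) < \<infinity>"
    using section_diff_fmeasurable[OF mw st] unfolding fmeasurable_def by blast+
next
  fix X :: "'a set" and N assume mw: "measured_walls X N"
  show "median_pseudo_metric_space (section_space X N) (section_pdist X N)"
    by (rule median_pseudo_metric_section_space[OF mw])
  show "pseudo_metric_on X (wall_pdist X N)"
    by (rule pseudo_metric_wall_pdist[OF mw])
  show "isometric_embedding X (wall_pdist X N) (section_space X N) (section_pdist X N)
      (point_section N)"
    by (rule isometric_embedding_point_section[OF mw])
next
  fix X :: "'a set" and N and X' :: "'b set" and N' \<phi>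
  assume "measured_walls X N" "measured_walls X' N'" "wall_hom X N X' N' \<phi>"
  then show "isometric_embedding (section_space X N) (section_pdist X N)
      (section_space X' N') (section_pdist X' N') (induced_section_map X N' \<phi>)"
    by (rule isometric_embedding_induced_section_map)
next
  fix X :: "'a set" and d assume "median_space X d"
  then interpret median_metric X d by (simp add: median_metric_iff)
  show "measured_walls X (canonical_walls X d)" by (rule measured_walls_canonical)
  show "emeasure (canonical_walls X d) Q = wall_outer_measure X d Q"
    if "X \<noteq> {}" "Q \<in> sets (canonical_walls X d)" for Q
    using that by (rule emeasure_canonical)
  show "wall_pdist X (canonical_walls X d) x y = d x y" if "x \<in> X" "y \<in> X" for x y
    using that by (rule wall_pdist_canonical)
  show "\<exists>(N :: 'a set set measure) f. isometric_embedding X d (L1_space N) (L1_dist N) f"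
    using L1_embedding by blast
next
  fix X :: "'a set" and d and X' :: "'b set" and d' \<phi>
  assume "median_space X d" "median_space X' d'"
    and "isometric_embedding X d X' d' \<phi>" "\<phi> ` X = X'"
  then show "wall_iso X (canonical_walls X d) X' (canonical_walls X' d') \<phi>"
    using wall_iso_canonical by (simp add: median_metric_iff)
qed

end
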